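(* For almost all (in the sense of Lebesgue measure) positive $c \in \mathbb{R}\setminus\mathbb{Z}$ and any fixed integer $a \geqslant 1$, we have $$\limsup_{x\to\infty} \frac{c\,\Pi_{c,a}(x)}{x/\log^2 x} \geqslant 1.$$
   Context: $\mathbb{P}$ denotes the set of prime numbers, and $\lfloor t\rfloor$ is the greatest integer $\leqslant t$. For a real number $c>0$, an integer $a$ and real $x$, define $$\Pi_{c,a}(x)=\#\{p\leqslant x : p\in\mathbb{P},\ \lfloor p^c\rfloor = q+a \text{ for some } q\in\mathbb{P}\}.$$ "Almost all" means that the set of exceptional $c$ has Lebesgue measure zero. *)

theory Defs
  imports "HOL-Analysis.Analysis" "HOL-Computational_Algebra.Primes"
begin

definition prime_shift_count :: "real \<Rightarrow> int \<Rightarrow> real \<Rightarrow> nat" where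
  "prime_shift_count c a x =
     card {p::nat. prime p \<and> real p \<le> x \<and> (\<exists>q::nat. prime q \<and> \<lfloor>real p powr c\<rfloor> = int q + a)}"

end

theory Submission
  imports Defs "HOL-Number_Theory.Totient" "HOL-Computational_Algebra.Squarefree"
    "HOL-Real_Asymp.Real_Asymp"
begin

text \<open>
  Write \<open>\<Pi>(c, n)\<close> for the counting function and integrate it over \<open>c\<close>. For a prime \<open>p\<close>, the
  \<open>c \<in> [\<alpha>, \<beta>]\<close> with \<open>\<lfloor>p\<^sup>c\<rfloor> = q + a\<close> form an interval of length about \<open>1 / (q ln p)\<close>, so by
  Mertens' estimate \<open>p\<close> contributes at least \<open>(\<beta> - \<alpha>) / (\<beta> ln p)\<close> up to a smaller error. Along a sequence of \<open>n\<close>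
  with \<open>\<pi>(n) \<ge> (1 - \<epsilon>) n / ln n\<close> the mean of \<open>c \<Pi>(c, n)\<close> over a short interval is thus at least
  about \<open>n / ln\<^sup>2 n\<close>.

  To pass from means to almost all \<open>c\<close> one has to exclude that this mass sits on a small set of
  \<open>c\<close>. Selberg's sieve, smoothed by Fejer kernels, bounds \<open>\<Pi>(c, n)\<close> by \<open>K n / ln\<^sup>2 n\<close> plus an error
  built from the sums of \<open>e(\<theta> p\<^sup>c)\<close> over \<open>p \<le> n\<close>. On average over \<open>c\<close> these sums are small, since
  \<open>p\<^sup>c - q\<^sup>c\<close> has a large monotone derivative in \<open>c\<close> for \<open>p \<noteq> q\<close>. If the limsup were below \<open>1\<close> on a
  set of positive measure, then in a short interval almost filled by such a set the mean would be
  too small.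
\<close>

section \<open>Selberg's weights\<close>

text \<open>The size of \<open>K\<close> is irrelevant: it only multiplies the measure of the part
  of a short interval that lies outside the supposed bad set, and that part can be made small in
  terms of \<open>K\<close>. Hence every constant factor in the sieve may be wasted. What matters is
  that the sieve bound holds for each single \<open>c\<close>, up to a nonnegative error whose
  integral over the whole range of \<open>c\<close> is small; such an error does no harm on any
  subset, however the bad set lies.

  Fejer kernels are used because they are nonnegative and have finitely many frequencies. Regrouped
  at one common level they keep the square in Selberg's sieve visible, and they turn the question
  how \<open>p powr c\<close> lies modulo \<open>D\<close> into exponential sums without any
  treatment of the floor.

  The bound is for a limsup because the constant \<open>1\<close> in the lower bound for the number
  of primes is drawn from Mertens' estimate, which gives it only along a sequence. The other
  estimates hold for all large \<open>n\<close>. Averaging over \<open>[\<alpha>, \<beta>]\<close>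
  gives \<open>1 / \<beta>\<close> where the assumed bound for bad \<open>c\<close> gives
  \<open>(1 - \<delta>) / \<alpha>\<close>, so the interval has to be short relative to
  \<open>\<delta>\<close>.\<close>

definition moebius_mu :: "nat \<Rightarrow> real" where
  "moebius_mu n = (if squarefree n then (-1) ^ card (prime_factors n) else 0)"

lemma abs_moebius_mu_le_1: "\<bar>moebius_mu n\<bar> \<le> 1"
  by (simp add: moebius_mu_def)

lemma moebius_1 [simp]: "moebius_mu 1 = 1" "moebius_mu (Suc 0) = 1"
  by (simp_all add: moebius_mu_def)

lemma moebius_prime_mult:
  assumes "prime l" "\<not> l dvd d" "squarefree (l * d)"
  shows "moebius_mu (l * d) = - moebius_mu d"
proof -
  have d: "d \<noteq> 0" using assms(3) by (intro notI) simp
  have "prime_factors (l * d) = insert l (prime_factors d)"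
    using assms(1) d by (simp add: prime_factors_product prime_prime_factors)
  moreover have "l \<notin> prime_factors d" using assms(2) by auto
  moreover have "squarefree d" using assms(3) by (rule squarefree_multD)
  ultimately show ?thesis using assms(3) by (simp add: moebius_mu_def)
qed

text \<open>A prime \<open>l\<close> dividing \<open>m / k\<close> pairs each admissible
  \<open>d\<close> not divisible by \<open>l\<close> with \<open>l * d\<close>, and the two values
  cancel. Since \<open>m\<close> is squarefree, \<open>l\<close> does not divide \<open>k\<close>,
  so both members of a pair lie above \<open>k\<close>.\<close>

lemma sum_moebius_between:
  assumes m: "squarefree (m :: nat)" and km: "k dvd m"
  shows "(\<Sum>d | k dvd d \<and> d dvd m. moebius_mu d) = (if k = m then moebius_mu m else 0)"
proof (cases "k = m")
  case True
  then have "{d. k dvd d \<and> d dvd m} = {m}" by (auto intro: dvd_antisym)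
  then show ?thesis using True by simp
next
  case False
  have m0: "m > 0" using m by (intro gr0I) auto
  obtain j where j: "m = k * j" using km by blast
  have "j \<noteq> 1" using False j by auto
  then obtain l where l: "prime l" "l dvd j" using prime_factor_nat by blast
  let ?D = "{d. k dvd d \<and> d dvd m}"
  let ?E = "{d\<in>?D. \<not> l dvd d}"
  have fin: "finite ?D" using m0 by (intro finite_subset[OF _ finite_divisors_nat[OF m0]]) auto
  have sq: "\<not> l ^ 2 dvd m" using m l by (auto simp: squarefree_def)
  have lk: "\<not> l dvd k"
  proof
    assume "l dvd k"
    with l j have "l * l dvd m" by (simp add: mult_dvd_mono)
    with sq show False by (simp add: power2_eq_square)
  qed
  have lm: "l dvd m" using l j by simp
  have ld: "l * d dvd m" if "d \<in> ?E" for d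
    using that l lm by (intro divides_mult) (auto simp: prime_imp_coprime)
  have eq: "?D = ?E \<union> (*) l ` ?E"
  proof (intro equalityI subsetI)
    fix d assume d: "d \<in> ?D"
    show "d \<in> ?E \<union> (*) l ` ?E"
    proof (cases "l dvd d")
      case True
      then obtain e where e: "d = l * e" by blast
      have "\<not> l dvd e"
      proof
        assume "l dvd e"
        then have "l * l dvd d" using e by simp
        with d sq show False by (auto simp: power2_eq_square dest: dvd_trans)
      qed
      moreover have "k dvd e" using d e lk l
        by (metis (mono_tags, lifting) coprime_commute coprime_dvd_mult_right_iff mem_Collect_eq prime_imp_coprime)
      moreover have "e dvd m" using d e by (metis (mono_tags, lifting) dvd_mult_right mem_Collect_eq)
      ultimately show ?thesis using e by auto
    qed (use d in auto)
  next
    fix d assume "d \<in> ?E \<union> (*) l ` ?E"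
    then have "d \<in> ?E \<or> (\<exists>e\<in>?E. d = l * e)" by auto
    then have "k dvd d \<and> d dvd m"
    proof
      assume "\<exists>e\<in>?E. d = l * e"
      then obtain e where e: "e \<in> ?E" "d = l * e" by blast
      have "k dvd d" using e by simp
      moreover have "d dvd m" using ld[OF e(1)] by (simp only: e(2))
      ultimately show ?thesis ..
    qed simp
    then show "d \<in> ?D" by simp
  qed
  have "sum moebius_mu ?D = sum moebius_mu ?E + sum moebius_mu ((*) l ` ?E)"
  proof (subst eq, rule sum.union_disjoint)
    show "finite ?E" by (rule finite_subset[OF _ fin]) auto
    then show "finite ((*) l ` ?E)" by simp
  qed auto
  also have "sum moebius_mu ((*) l ` ?E) = (\<Sum>d\<in>?E. moebius_mu (l * d))"
    using l by (subst sum.reindex) (auto intro!: inj_onI)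
  also have "\<dots> = (\<Sum>d\<in>?E. - moebius_mu d)"
  proof (intro sum.cong refl)
    fix d assume d: "d \<in> ?E"
    have "squarefree (l * d)" using ld[OF d] m by (rule squarefree_mono)
    then show "moebius_mu (l * d) = - moebius_mu d"
      using d l by (intro moebius_prime_mult) auto
  qed
  finally have "sum moebius_mu ?D = 0" by (simp only: sum_negf add.right_inverse)
  then show ?thesis using False by simp
qed

definition sqfree_harm :: "nat \<Rightarrow> real" where
  "sqfree_harm R = (\<Sum>k | k \<in> {1..R} \<and> squarefree k. 1 / real k)"

lemma sum_inverse_squares_le_2: "(\<Sum>m=1..n. 1 / (real m)\<^sup>2) \<le> 2"
proof -
  \<comment> \<open>The sharper bound makes the induction telescope.\<close>
  have "(\<Sum>m=1..n. 1 / (real m)\<^sup>2) \<le> 2 - 1 / real n" if "n > 0" for n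
    using that
  proof (induction n rule: nat_induct_non_zero)
    case (Suc n)
    have "1 / (1 + real n)\<^sup>2 \<le> 1 / real n - 1 / (1 + real n)"
    proof -
      have "1 / (1 + real n)\<^sup>2 \<le> 1 / (real n * (1 + real n))"
        using Suc by (intro divide_left_mono) (auto simp: power2_eq_square)
      also have "\<dots> = 1 / real n - 1 / (1 + real n)"
        using Suc by (simp add: field_simps)
      finally show ?thesis .
    qed
    then show ?case using Suc by simp
  qed simp
  from this[of n] show ?thesis by (cases "n = 0") (auto intro: order_trans)
qed

text \<open>Writing \<open>n\<close> as a squarefree number times a square bounds the full harmonic
  sum by \<open>sqfree_harm R\<close> times the sum of inverse squares, which is at most
  \<open>2\<close>.\<close>

lemma sqfree_harm_ge: "sqfree_harm R \<ge> ln (real R + 1) / 2"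
proof -
  let ?K = "{k. k \<in> {1..R} \<and> squarefree k}"
  let ?P = "?K \<times> {1..R}"
  let ?f = "\<lambda>n. (squarefree_part n, square_part n :: nat)"
  have dec: "n = squarefree_part n * (square_part n)\<^sup>2" for n :: nat
    by (rule squarefree_decompose)
  have inj: "inj_on ?f {1..R}"
    by (rule inj_onI) (metis dec prod.inject)
  have img: "?f ` {1..R} \<subseteq> ?P"
  proof safe
    fix n assume n: "n \<in> {1..R}"
    have 1: "squarefree_part n dvd n" "square_part n dvd n"
      using dec[of n] by (metis dvd_triv_left, metis dvd_triv_right dvd_trans dvd_power pos2)
    then have le: "squarefree_part n \<le> n" "square_part n \<le> n" "squarefree_part n > 0" "square_part n > 0"
      using n by (auto intro!: dvd_imp_le Nat.gr0I)
    from n le show "squarefree_part n \<in> {1..R}" "square_part n \<in> {1..R}" by auto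
  qed auto
  have "ln (real R + 1) \<le> harm R" by (rule ln_le_harm)
  also have "\<dots> = (\<Sum>n=1..R. 1 / real n)" by (simp add: harm_def inverse_eq_divide)
  also have "\<dots> = (\<Sum>n=1..R. (\<lambda>(k,m). 1 / real k * (1 / (real m)\<^sup>2)) (?f n))"
    by (intro sum.cong refl) (subst (1) dec, simp)
  also have "\<dots> = (\<Sum>(k,m)\<in>?f ` {1..R}. 1 / real k * (1 / (real m)\<^sup>2))"
    by (subst sum.reindex[OF inj]) simp
  also have "\<dots> \<le> (\<Sum>(k,m)\<in>?P. 1 / real k * (1 / (real m)\<^sup>2))"
    using img by (intro sum_mono2) auto
  also have "\<dots> = sqfree_harm R * (\<Sum>m=1..R. 1 / (real m)\<^sup>2)"
    by (simp add: sqfree_harm_def sum_product sum.cartesian_product)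
  also have "\<dots> \<le> sqfree_harm R * 2"
    by (intro mult_left_mono sum_inverse_squares_le_2) (auto simp: sqfree_harm_def intro!: sum_nonneg)
  finally show ?thesis by simp
qed

text \<open>Selberg's weights, with \<open>1 / k\<close> in place of the optimal \<open>1 / totient k\<close>:
  this loses only a constant factor.\<close>
definition selberg_weight :: "nat \<Rightarrow> nat \<Rightarrow> real" where
  "selberg_weight R d = moebius_mu d * real d / sqfree_harm R *
     (\<Sum>k | k \<in> {1..R} \<and> squarefree k \<and> d dvd k. 1 / real k)"

lemma sqfree_harm_pos:
  assumes "R \<ge> 1"
  shows "sqfree_harm R > 0"
proof -
  have "ln (real R + 1) > 0" using assms by simp
  then show ?thesis using sqfree_harm_ge[of R] by linarith
qed

lemma selberg_weight_1: "R \<ge> 1 \<Longrightarrow> selberg_weight R 1 = 1"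
  using sqfree_harm_pos[of R] by (simp add: selberg_weight_def sqfree_harm_def)

text \<open>The inner sum is part of \<open>sqfree_harm R\<close>. This is crude, but the surplus
  only costs powers of \<open>R\<close> in the error term, where a power of \<open>n\<close> is
  saved.\<close>

lemma abs_selberg_weight_le: "\<bar>selberg_weight R d\<bar> \<le> real d"
proof (cases "R \<ge> 1")
  case True
  let ?s = "\<Sum>k | k \<in> {1..R} \<and> squarefree k \<and> d dvd k. 1 / real k"
  have s: "0 \<le> ?s" "?s \<le> sqfree_harm R"
    unfolding sqfree_harm_def by (auto intro!: sum_nonneg sum_mono2)
  have "\<bar>selberg_weight R d\<bar> = \<bar>moebius_mu d\<bar> * (real d * (?s / sqfree_harm R))"
    using s sqfree_harm_pos[OF True] by (simp add: selberg_weight_def abs_mult)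
  also have "\<dots> \<le> 1 * (real d * 1)"
    using s sqfree_harm_pos[OF True] by (intro mult_mono abs_moebius_mu_le_1) auto
  finally show ?thesis by simp
qed (simp add: selberg_weight_def)

text \<open>Moebius inversion: after exchanging the sums, the inner sum over \<open>d\<close>
  between \<open>k\<close> and \<open>m\<close> vanishes unless \<open>m = k\<close>. These are the
  coordinates in which the quadratic form of the sieve is diagonal.\<close>

lemma selberg_weight_dual:
  assumes R: "R \<ge> 1" and k: "k \<in> {1..R}"
  shows "(\<Sum>d | d \<in> {1..R} \<and> k dvd d. selberg_weight R d / real d)
       = (if squarefree k then moebius_mu k / (real k * sqfree_harm R) else 0)"
proof -
  let ?M = "{m. m \<in> {1..R} \<and> squarefree m}"
  have "(\<Sum>d | d \<in> {1..R} \<and> k dvd d. selberg_weight R d / real d)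
      = (\<Sum>d | d \<in> {1..R} \<and> k dvd d. \<Sum>m | m \<in> ?M \<and> d dvd m. moebius_mu d / (sqfree_harm R * real m))"
    by (intro sum.cong refl) (auto simp: selberg_weight_def sum_distrib_left sum_divide_distrib conj_assoc intro!: sum.cong)
  also have "\<dots> = (\<Sum>m\<in>?M. \<Sum>d | (d \<in> {1..R} \<and> k dvd d) \<and> d dvd m. moebius_mu d / (sqfree_harm R * real m))"
    using sum.swap_restrict[of "{d. d \<in> {1..R} \<and> k dvd d}" ?M
        "\<lambda>d m. moebius_mu d / (sqfree_harm R * real m)" "(dvd)"] by simp
  also have "\<dots> = (\<Sum>m\<in>?M. if m = k then moebius_mu k / (real k * sqfree_harm R) else 0)"
  proof (intro sum.cong refl)
    fix m assume m: "m \<in> ?M"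
    have "{d. (d \<in> {1..R} \<and> k dvd d) \<and> d dvd m} = {d. k dvd d \<and> d dvd m}"
      using m by (auto dest: dvd_imp_le intro!: Suc_leI Nat.gr0I)
    then have "(\<Sum>d | (d \<in> {1..R} \<and> k dvd d) \<and> d dvd m. moebius_mu d / (sqfree_harm R * real m))
        = (\<Sum>d | k dvd d \<and> d dvd m. moebius_mu d) / (sqfree_harm R * real m)"
      by (simp add: sum_divide_distrib)
    also have "\<dots> = (if m = k then moebius_mu k / (real k * sqfree_harm R) else 0)"
    proof (cases "k dvd m")
      case True
      then show ?thesis using sum_moebius_between[of m k] m by (auto simp: mult.commute)
    next
      case False
      then have "{d. k dvd d \<and> d dvd m} = {}" by (auto dest: dvd_trans)
      then have "(\<Sum>d | k dvd d \<and> d dvd m. moebius_mu d) = 0" by (simp only: sum.empty)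
      moreover have "m \<noteq> k" using False by auto
      ultimately show ?thesis by simp
    qed
    finally show "(\<Sum>d | (d \<in> {1..R} \<and> k dvd d) \<and> d dvd m. moebius_mu d / (sqfree_harm R * real m)) = \<dots>" .
  qed
  also have "\<dots> = (if squarefree k then moebius_mu k / (real k * sqfree_harm R) else 0)"
    using k by (simp add: sum.delta)
  finally show ?thesis .
qed

text \<open>Since \<open>1 / lcm d e = gcd d e / (d * e)\<close> and a gcd is the sum of
  \<open>totient k\<close> over the common divisors \<open>k\<close>, the form is a sum of squares
  of the dual coordinates. With \<open>totient k \<le> k\<close> it is at most
  \<open>1 / sqfree_harm R\<close>; the \<open>2\<close> comes from the lower bound for
  \<open>sqfree_harm R\<close>.\<close>

lemma selberg_quadratic_form:
  assumes R: "R \<ge> 1"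
  shows "(\<Sum>d=1..R. \<Sum>e=1..R. selberg_weight R d * selberg_weight R e / real (lcm d e))
         \<le> 2 / ln (real R + 1)"
proof -
  let ?l = "selberg_weight R" and ?S = "sqfree_harm R"
  have gcd_sum: "real (gcd d e) = (\<Sum>k | k \<in> {1..R} \<and> k dvd d \<and> k dvd e. real (totient k))"
    if "d \<in> {1..R}" "e \<in> {1..R}" for d e
  proof -
    have "{k. k dvd gcd d e} = {k. k \<in> {1..R} \<and> k dvd d \<and> k dvd e}"
      using that by (auto dest: dvd_imp_le intro!: Suc_leI Nat.gr0I)
    then show ?thesis using totient_divisor_sum[of "gcd d e"] by (metis of_nat_sum)
  qed
  have "(\<Sum>d=1..R. \<Sum>e=1..R. ?l d * ?l e / real (lcm d e))
      = (\<Sum>d=1..R. \<Sum>e=1..R. \<Sum>k=1..R. real (totient k) *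
           ((if k dvd d then ?l d / d else 0) * (if k dvd e then ?l e / e else 0)))"
  proof (intro sum.cong refl)
    fix d e assume de: "d \<in> {1..R}" "e \<in> {1..R}"
    have "real (lcm d e) = real d * real e / real (gcd d e)"
      using de by (simp add: lcm_nat_def real_of_nat_div)
    then have "?l d * ?l e / real (lcm d e) = real (gcd d e) * (?l d / d * (?l e / e))"
      by (simp add: field_simps)
    also have "\<dots> = (\<Sum>k | k \<in> {1..R} \<and> k dvd d \<and> k dvd e. real (totient k) * (?l d / d * (?l e / e)))"
      by (simp only: gcd_sum[OF de] sum_distrib_right)
    also have "\<dots> = (\<Sum>k=1..R. real (totient k) *
           ((if k dvd d then ?l d / d else 0) * (if k dvd e then ?l e / e else 0)))"
      by (intro sum.mono_neutral_cong_left) auto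
    finally show "?l d * ?l e / real (lcm d e) = \<dots>" .
  qed
  also have "\<dots> = (\<Sum>k=1..R. \<Sum>d=1..R. \<Sum>e=1..R. real (totient k) *
           ((if k dvd d then ?l d / d else 0) * (if k dvd e then ?l e / e else 0)))"
    by (subst (2) sum.swap, subst sum.swap, rule refl)
  also have "\<dots> = (\<Sum>k=1..R. real (totient k) * (\<Sum>d=1..R. if k dvd d then ?l d / d else 0)\<^sup>2)"
    by (subst power2_eq_square, subst sum_product) (simp only: sum_distrib_left)
  also have "\<dots> = (\<Sum>k=1..R. real (totient k) * (\<Sum>d | d \<in> {1..R} \<and> k dvd d. ?l d / d)\<^sup>2)"
  proof -
    have "(\<Sum>d=1..R. if k dvd d then ?l d / d else 0) = (\<Sum>d | d \<in> {1..R} \<and> k dvd d. ?l d / d)" for k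
      by (intro sum.mono_neutral_cong_right) auto
    then show ?thesis by simp
  qed
  also have "\<dots> = (\<Sum>k=1..R. real (totient k) * (if squarefree k then moebius_mu k / (real k * ?S) else 0)\<^sup>2)"
    by (intro sum.cong refl) (simp only: selberg_weight_dual[OF R])
  also have "\<dots> \<le> (\<Sum>k=1..R. if squarefree k then 1 / real k / ?S\<^sup>2 else 0)"
  proof (intro sum_mono)
    fix k assume k: "k \<in> {1..R}"
    have "real (totient k) * (moebius_mu k / (real k * ?S))\<^sup>2 \<le> real k * (1 / (real k * ?S))\<^sup>2"
      if "squarefree k"
      using that by (intro mult_mono) (auto simp: totient_le moebius_mu_def power_divide simp flip: power_mult)
    also have "\<dots> = 1 / real k / ?S\<^sup>2" using k by (simp add: field_simps power2_eq_square)
    finally show "real (totient k) * (if squarefree k then moebius_mu k / (real k * ?S) else 0)\<^sup>2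
        \<le> (if squarefree k then 1 / real k / ?S\<^sup>2 else 0)" by auto
  qed
  also have "\<dots> = ?S / ?S\<^sup>2"
  proof -
    have "(\<Sum>k=1..R. if squarefree k then 1 / real k / ?S\<^sup>2 else 0)
        = (\<Sum>k | k \<in> {1..R} \<and> squarefree k. 1 / real k / ?S\<^sup>2)"
      by (intro sum.mono_neutral_cong_right) auto
    then show ?thesis by (simp only: sum_divide_distrib[symmetric] sqfree_harm_def[of R, symmetric])
  qed
  also have "\<dots> = 1 / ?S" using sqfree_harm_pos[OF R] by (simp add: power2_eq_square)
  also have "\<dots> \<le> 1 / (ln (real R + 1) / 2)"
    using R sqfree_harm_ge[of R] by (intro divide_left_mono mult_pos_pos) (auto simp: sqfree_harm_pos)
  finally show ?thesis by simp
qed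

section \<open>Fejer kernels and the sieve majorant\<close>

text \<open>For \<open>D > 0\<close> this is the squared modulus of the mean of the exponentials
  \<open>e(h * y / D)\<close> over \<open>h < D\<close>. At integers it is the indicator of
  divisibility by \<open>D\<close>, and its constant Fourier coefficient is
  \<open>1 / D\<close>.\<close>

definition fejer :: "nat \<Rightarrow> real \<Rightarrow> real" where
  "fejer D y = (\<Sum>h<D. \<Sum>k<D. cos (2 * pi * (real h - real k) * y / D)) / (real D)\<^sup>2"

lemma norm_sum_cis_squared:
  "(norm (\<Sum>x\<in>A. cis (f x)))\<^sup>2 = (\<Sum>x\<in>A. \<Sum>y\<in>A. cos (f x - f y))"
proof -
  have "(norm (\<Sum>x\<in>A. cis (f x)))\<^sup>2 = (\<Sum>x\<in>A. cos (f x))\<^sup>2 + (\<Sum>x\<in>A. sin (f x))\<^sup>2"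
    by (simp add: cmod_power2)
  also have "\<dots> = (\<Sum>x\<in>A. \<Sum>y\<in>A. cos (f x) * cos (f y) + sin (f x) * sin (f y))"
    by (simp add: power2_eq_square sum_product sum.distrib)
  also have "\<dots> = (\<Sum>x\<in>A. \<Sum>y\<in>A. cos (f x - f y))"
    by (simp add: cos_diff)
  finally show ?thesis .
qed

lemma fejer_nonneg: "fejer D y \<ge> 0"
proof -
  have "fejer D y = (norm (\<Sum>h<D. cis (2 * pi * real h * y / D)))\<^sup>2 / (real D)\<^sup>2"
    unfolding norm_sum_cis_squared fejer_def by (simp add: algebra_simps diff_divide_distrib)
  then show ?thesis by simp
qed

text \<open>Because \<open>h\<close> and \<open>k\<close> differ by less than \<open>D\<close>,
  every phase is at most \<open>pi / 3\<close> in absolute value, whatever \<open>D\<close> is. This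
  is the origin of the radius \<open>1 / 6\<close>.\<close>

lemma fejer_ge_half:
  assumes D: "D > 0" and y: "\<bar>y\<bar> \<le> 1 / 6"
  shows "fejer D y \<ge> 1 / 2"
proof -
  have "cos (2 * pi * (real h - real k) * y / D) \<ge> 1 / 2" if "h < D" "k < D" for h k
  proof -
    have hk: "\<bar>real h - real k\<bar> \<le> real D" using that by linarith
    have "\<bar>2 * pi * (real h - real k) * y / D\<bar> = 2 * pi * (\<bar>real h - real k\<bar> / D) * \<bar>y\<bar>"
      by (simp add: abs_mult)
    also have "\<dots> \<le> 2 * pi * 1 * (1 / 6)"
      using hk y D by (intro mult_mono) auto
    finally have "\<bar>2 * pi * (real h - real k) * y / D\<bar> \<le> pi / 3" by simp
    then have "cos (pi / 3) \<le> cos \<bar>2 * pi * (real h - real k) * y / D\<bar>"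
      by (intro cos_monotone_0_pi_le) auto
    then show ?thesis by (simp only: cos_60 cos_abs_real)
  qed
  then have "(\<Sum>h<D. \<Sum>k<D. 1 / 2) \<le> (\<Sum>h<D. \<Sum>k<D. cos (2 * pi * (real h - real k) * y / D))"
    by (intro sum_mono) auto
  then show ?thesis using D by (simp add: fejer_def field_simps power2_eq_square)
qed

lemma fejer_periodic: "fejer D (y + real_of_int j * real D) = fejer D y"
proof (cases "D = 0")
  case False
  have "cos (2 * pi * (real h - real k) * (y + real_of_int j * real D) / D)
      = cos (2 * pi * (real h - real k) * y / D)" for h k :: nat
  proof -
    have "2 * pi * (real h - real k) * (y + real_of_int j * real D) / D
       = 2 * pi * (real h - real k) * y / D + 2 * pi * of_int ((int h - int k) * j)"
      using False by (simp add: field_simps)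
    also have "cos \<dots> = cos (2 * pi * (real h - real k) * y / D)"
      by (subst cos_add) (simp only: cos_int_2pin sin_int_2pin mult_1_right mult_zero_right diff_zero)
    finally show ?thesis .
  qed
  then show ?thesis by (simp add: fejer_def)
qed (simp add: fejer_def)

lemma sum_cis_roots_of_unity:
  assumes "N > 0"
  shows "(\<Sum>t<N. cis (2 * pi * real_of_int j * real t / real N)) = (if int N dvd j then of_nat N else 0)"
proof -
  let ?w = "cis (2 * pi * real_of_int j / real N)"
  have pw: "cis (2 * pi * real_of_int j * real t / real N) = ?w ^ t" for t
  proof -
    have "2 * pi * real_of_int j * real t / real N = real t * (2 * pi * real_of_int j / real N)" by simp
    then show ?thesis by (simp only: Complex.DeMoivre)
  qed
  have iff: "?w = 1 \<longleftrightarrow> int N dvd j"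
  proof
    assume "?w = 1"
    then have "cos (2 * pi * real_of_int j / real N) = 1" by (simp add: complex_eq_iff)
    then obtain m :: int where "2 * pi * real_of_int j / real N = of_int m * 2 * pi"
      using cos_one_2pi_int by blast
    then have "real_of_int j = of_int m * real N" using assms by (simp add: field_simps)
    then have "j = m * int N" by (metis of_int_eq_iff of_int_mult of_int_of_nat_eq)
    then show "int N dvd j" by simp
  next
    assume "int N dvd j"
    then obtain m where "j = int N * m" by blast
    then have "2 * pi * real_of_int j / real N = 2 * pi * of_int m" using assms by simp
    then show "?w = 1" by (simp only: cis_multiple_2pi Ints_of_int)
  qed
  show ?thesis
  proof (cases "int N dvd j")
    case True
    then show ?thesis using iff by (simp add: pw)
  next
    case False
    have "?w ^ N = cis (2 * pi * of_int j)" using assms by (simp add: Complex.DeMoivre)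
    also have "\<dots> = 1" by (simp add: cis_multiple_2pi)
    finally show ?thesis using False iff
      by (simp add: pw sum_gp_strict)
  qed
qed

lemma sum_cos_residues:
  assumes "N > 0"
  shows "(\<Sum>t<N. cos (\<theta> - 2 * pi * real_of_int j * real t / real N))
       = (if int N dvd j then real N * cos \<theta> else 0)"
proof -
  have "(\<Sum>t<N. cos (\<theta> - 2 * pi * real_of_int j * real t / real N))
     = Re (cis \<theta> * cnj (\<Sum>t<N. cis (2 * pi * real_of_int j * real t / real N)))"
    by (simp add: cos_diff sum_distrib_left sum.distrib)
  then show ?thesis by (simp add: sum_cis_roots_of_unity[OF assms])
qed

lemma bij_betw_div_mod:
  assumes "N > 0"
  shows "bij_betw (\<lambda>(r, s). r + N * s) ({..<N} \<times> {..<D}) {..<N * D :: nat}"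
proof (rule bij_betwI[where g = "\<lambda>h. (h mod N, h div N)"])
  show "(\<lambda>(r, s). r + N * s) \<in> {..<N} \<times> {..<D} \<rightarrow> {..<N * D}"
  proof safe
    fix r s assume "r < N" "s < D"
    then have "r + N * s < N + N * s" "N * Suc s \<le> N * D" by (simp, intro mult_left_mono) auto
    then show "r + N * s < N * D" by simp
  qed
  show "(\<lambda>h. (h mod N, h div N)) \<in> {..<N * D} \<rightarrow> {..<N} \<times> {..<D}"
    using assms by (auto simp: less_mult_imp_div_less mult.commute)
qed (use assms in auto)

text \<open>Detecting multiples of \<open>D\<close> by the additive characters modulo \<open>M div D\<close> turns the
  kernel of level \<open>M\<close> into the one of level \<open>D\<close>.\<close>
lemma sum_fejer_multiples:
  assumes "D dvd M" "M > 0"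
  shows "(\<Sum>m | m < M \<and> D dvd m. fejer M (y - real m)) = fejer D y"
proof -
  obtain N where M: "M = N * D" using assms(1) by (metis dvd_def mult.commute)
  have N: "N > 0" and D: "D > 0" using assms(2) M by auto
  let ?c = "\<lambda>h k. cos (2 * pi * (real h - real k) * y / M)"
  have bij: "bij_betw (\<lambda>t. D * t) {..<N} {m. m < M \<and> D dvd m}"
    using D by (intro bij_betwI[where g = "\<lambda>m. m div D"]) (auto simp: M less_mult_imp_div_less mult.commute)
  have "(\<Sum>m | m < M \<and> D dvd m. fejer M (y - real m)) = (\<Sum>t<N. fejer M (y - real (D * t)))"
    by (rule sum.reindex_bij_betw[OF bij, symmetric])
  also have "\<dots> = (\<Sum>t<N. \<Sum>h<M. \<Sum>k<M. cos (2 * pi * (real h - real k) * (y - real (D * t)) / M)) / (real M)\<^sup>2"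
    by (simp only: fejer_def sum_divide_distrib)
  also have "(\<Sum>t<N. \<Sum>h<M. \<Sum>k<M. cos (2 * pi * (real h - real k) * (y - real (D * t)) / M))
     = (\<Sum>h<M. \<Sum>k<M. \<Sum>t<N. cos (2 * pi * (real h - real k) * (y - real (D * t)) / M))"
    by (subst sum.swap, subst (2) sum.swap, rule refl)
  also have "\<dots> = (\<Sum>h<M. \<Sum>k<M. if int N dvd int h - int k then real N * ?c h k else 0)"
  proof (intro sum.cong refl)
    fix h k :: nat
    have "2 * pi * (real h - real k) * (y - real (D * t)) / M
        = 2 * pi * (real h - real k) * y / M - 2 * pi * real_of_int (int h - int k) * real t / real N" for t
      using N D by (simp add: M field_simps)
    then show "(\<Sum>t<N. cos (2 * pi * (real h - real k) * (y - real (D * t)) / M))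
        = (if int N dvd int h - int k then real N * ?c h k else 0)"
      by (simp only: sum_cos_residues[OF N])
  qed
  \<comment> \<open>Splitting \<open>h\<close> and \<open>k\<close> into residue and quotient modulo
    \<open>N\<close> turns the congruence into \<open>r = r'\<close>. The surviving frequency
    \<open>N * (s - s') / (N * D)\<close> is one of level \<open>D\<close>, and the \<open>N\<close>
    choices of \<open>r\<close> supply the second factor \<open>N\<close>.\<close>
  also have "\<dots> = (\<Sum>(r,s)\<in>{..<N}\<times>{..<D}. \<Sum>(r',s')\<in>{..<N}\<times>{..<D}.
       if int N dvd int (r + N * s) - int (r' + N * s') then real N * ?c (r + N * s) (r' + N * s') else 0)"
    unfolding M
    by (subst sum.reindex_bij_betw[OF bij_betw_div_mod[OF N], symmetric],
        subst sum.reindex_bij_betw[OF bij_betw_div_mod[OF N], symmetric])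
       (simp only: case_prod_unfold)
  also have "\<dots> = (\<Sum>(r,s)\<in>{..<N}\<times>{..<D}. \<Sum>(r',s')\<in>{..<N}\<times>{..<D}.
       if r = r' then real N * cos (2 * pi * (real s - real s') * y / D) else 0)"
  proof -
    have core: "(if int N dvd int (r + N * s) - int (r' + N * s') then real N * ?c (r + N * s) (r' + N * s') else 0)
       = (if r = r' then real N * cos (2 * pi * (real s - real s') * y / D) else 0)"
      if r: "r \<in> {..<N}" "r' \<in> {..<N}" for r s r' s'
    proof -
    have "int N dvd int (r + N * s) - int (r' + N * s') \<longleftrightarrow> int N dvd int r - int r'"
    proof -
      have "int (r + N * s) - int (r' + N * s') = (int r - int r') + int N * (int s - int s')"
        by (simp add: algebra_simps)
      then show ?thesis by (simp only: dvd_add_left_iff dvd_triv_left)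
    qed
    also have "\<dots> \<longleftrightarrow> r = r'"
      using r zdvd_imp_le[of "int N" "int r - int r'"] zdvd_imp_le[of "int N" "int r' - int r"]
        dvd_diff_commute[of "int N" "int r" "int r'"]
      by (cases r r' rule: linorder_cases) auto
    finally have iff: "int N dvd int (r + N * s) - int (r' + N * s') \<longleftrightarrow> r = r'" .
    have "2 * pi * (real (r + N * s) - real (r + N * s')) * y / M = 2 * pi * (real s - real s') * y / D"
      using N D by (simp add: M field_simps)
    then show ?thesis using iff by auto
    qed
    show ?thesis unfolding case_prod_unfold by (intro sum.cong refl core) auto
  qed
  also have "\<dots> = (\<Sum>r<N. \<Sum>s<D. \<Sum>r'<N. \<Sum>s'<D.
       if r = r' then real N * cos (2 * pi * (real s - real s') * y / D) else 0)"
    by (simp only: sum.cartesian_product[symmetric])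
  also have "\<dots> = (\<Sum>r<N. \<Sum>s<D. \<Sum>s'<D. \<Sum>r'<N.
       if r = r' then real N * cos (2 * pi * (real s - real s') * y / D) else 0)"
    by (subst (3) sum.swap, rule refl)
  also have "\<dots> = (real N)\<^sup>2 * (\<Sum>s<D. \<Sum>s'<D. cos (2 * pi * (real s - real s') * y / D))"
    by (simp add: sum_distrib_left power2_eq_square mult.assoc)
  also have "\<dots> / (real M)\<^sup>2 = fejer D y"
    using N by (simp add: fejer_def M power_mult_distrib)
  finally show ?thesis .
qed

section \<open>The smoothed sieve majorant\<close>

text \<open>At an integer \<open>y\<close> this is Selberg's square of the sum of
  \<open>selberg_weight R d\<close> over the divisors \<open>d \<le> R\<close> of \<open>y\<close>,
  with the kernels in place of the condition that both \<open>d\<close> and \<open>e\<close> divide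
  \<open>y\<close>.\<close>

definition selberg_majorant :: "nat \<Rightarrow> real \<Rightarrow> real" where
  "selberg_majorant R y =
     (\<Sum>d=1..R. \<Sum>e=1..R. selberg_weight R d * selberg_weight R e * fejer (lcm d e) y)"

text \<open>The defining sum has terms of both signs. Every \<open>lcm d e\<close> divides
  \<open>fact R\<close>, so all kernels can be written at this one level, where the weights combine
  to squares with nonnegative coefficients.\<close>

lemma selberg_majorant_altdef:
  "selberg_majorant R y =
     (\<Sum>m<fact R. fejer (fact R) (y - real m) * (\<Sum>d | d \<in> {1..R} \<and> d dvd m. selberg_weight R d)\<^sup>2)"
proof -
  let ?l = "selberg_weight R" and ?M = "fact R :: nat"
  have "selberg_majorant R y = (\<Sum>d=1..R. \<Sum>e=1..R. \<Sum>m<?M.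
      fejer ?M (y - real m) * ((if d dvd m then ?l d else 0) * (if e dvd m then ?l e else 0)))"
    unfolding selberg_majorant_def
  proof (intro sum.cong refl)
    fix d e assume de: "d \<in> {1..R}" "e \<in> {1..R}"
    have "lcm d e dvd ?M" using de by (intro lcm_least dvd_fact) auto
    then have "fejer (lcm d e) y = (\<Sum>m | m < ?M \<and> lcm d e dvd m. fejer ?M (y - real m))"
      by (rule sum_fejer_multiples[symmetric]) simp
    then have "?l d * ?l e * fejer (lcm d e) y
        = (\<Sum>m | m < ?M \<and> lcm d e dvd m. ?l d * ?l e * fejer ?M (y - real m))"
      by (simp only: sum_distrib_left)
    also have "\<dots> = (\<Sum>m<?M. fejer ?M (y - real m) * ((if d dvd m then ?l d else 0) * (if e dvd m then ?l e else 0)))"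
      by (intro sum.mono_neutral_cong_left) auto
    finally show "?l d * ?l e * fejer (lcm d e) y = \<dots>" .
  qed
  also have "\<dots> = (\<Sum>m<?M. \<Sum>d=1..R. \<Sum>e=1..R. 
      fejer ?M (y - real m) * ((if d dvd m then ?l d else 0) * (if e dvd m then ?l e else 0)))"
    by (subst (2) sum.swap, subst sum.swap, rule refl)
  also have "\<dots> = (\<Sum>m<?M. fejer ?M (y - real m) * (\<Sum>d=1..R. if d dvd m then ?l d else 0)\<^sup>2)"
    by (subst power2_eq_square, subst sum_product) (simp only: sum_distrib_left)
  also have "\<dots> = (\<Sum>m<?M. fejer ?M (y - real m) * (\<Sum>d | d \<in> {1..R} \<and> d dvd m. ?l d)\<^sup>2)"
  proof -
    have "(\<Sum>d=1..R. if d dvd m then ?l d else 0) = (\<Sum>d | d \<in> {1..R} \<and> d dvd m. ?l d)" for m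
      by (intro sum.mono_neutral_cong_right) auto
    then show ?thesis by simp
  qed
  finally show ?thesis .
qed

lemma selberg_majorant_nonneg: "selberg_majorant R y \<ge> 0"
  unfolding selberg_majorant_altdef by (intro sum_nonneg mult_nonneg_nonneg fejer_nonneg) simp

text \<open>The single term \<open>m = q mod fact R\<close> suffices: no divisor of it up to
  \<open>R\<close> other than \<open>1\<close> exists because \<open>q > R\<close> is prime, so its
  square is \<open>1\<close>, and by periodicity its kernel is evaluated within \<open>1 / 6\<close>
  of \<open>0\<close>.\<close>

lemma selberg_majorant_ge_half:
  assumes R: "R \<ge> 1" and q: "prime q" "q > R" and y: "\<bar>y - real q\<bar> \<le> 1 / 6"
  shows "selberg_majorant R y \<ge> 1 / 2"
proof -
  let ?M = "fact R :: nat"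
  let ?m = "q mod ?M"
  have "{d. d \<in> {1..R} \<and> d dvd ?m} = {1}"
  proof (intro equalityI subsetI)
    fix d assume d: "d \<in> {d. d \<in> {1..R} \<and> d dvd ?m}"
    then have "d dvd ?M" by (intro dvd_fact) auto
    moreover have "d dvd ?m" using d by blast
    ultimately have "d dvd q" by (simp only: dvd_mod_iff)
    then have "d = 1 \<or> d = q" using q(1) by (simp only: prime_nat_iff)
    moreover have "d \<le> R" using d by simp
    ultimately show "d \<in> {1}" using q(2) by simp
  qed (use R in auto)
  then have w: "(\<Sum>d | d \<in> {1..R} \<and> d dvd ?m. selberg_weight R d) = 1"
    using selberg_weight_1[OF R] by (simp only: sum.insert sum.empty finite.emptyI empty_iff) simp
  have "y - real ?m = (y - real q) + real_of_int (int (q div ?M)) * real ?M"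
  proof -
    have "real q = real (q div ?M * ?M + ?m)" by (simp only: div_mult_mod_eq)
    also have "\<dots> = real_of_int (int (q div ?M)) * real ?M + real ?m"
      by (simp only: of_nat_add of_nat_mult of_int_of_nat_eq)
    finally show ?thesis by linarith
  qed
  then have "fejer ?M (y - real ?m) = fejer ?M (y - real q)" by (simp only: fejer_periodic)
  also have "\<dots> \<ge> 1 / 2" using y by (intro fejer_ge_half) auto
  finally have "1 / 2 \<le> fejer ?M (y - real ?m) * (\<Sum>d | d \<in> {1..R} \<and> d dvd ?m. selberg_weight R d)\<^sup>2"
    by (simp only: w one_power2 mult_1_right)
  also have "\<dots> \<le> selberg_majorant R y"
    unfolding selberg_majorant_altdef
    by (rule member_le_sum[of ?m]) (auto intro!: mult_nonneg_nonneg fejer_nonneg)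
  finally show ?thesis .
qed

section \<open>Exponential sums on average over the exponent\<close>

text \<open>A one-sided first derivative test. An upper bound is enough, since a mean square expands
  into a sum of such integrals.\<close>

lemma integral_cos_phase_le:
  fixes \<phi> \<phi>' \<phi>'' :: "real \<Rightarrow> real"
  assumes "a \<le> b"
    and d1: "\<And>x. x \<in> {a..b} \<Longrightarrow> (\<phi> has_real_derivative \<phi>' x) (at x)"
    and d2: "\<And>x. x \<in> {a..b} \<Longrightarrow> (\<phi>' has_real_derivative \<phi>'' x) (at x)"
    and pos: "\<And>x. x \<in> {a..b} \<Longrightarrow> \<phi>'' x \<ge> 0"
    and lam: "\<And>x. x \<in> {a..b} \<Longrightarrow> \<phi>' x \<ge> l" "l > 0"
  shows "integral {a..b} (\<lambda>x. cos (\<phi> x)) \<le> 2 / l"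
proof -
  \<comment> \<open>The derivative of \<open>H\<close> is at least \<open>cos \<circ> \<phi>\<close>, because \<open>sin \<le> 1\<close>.\<close>
  define H where "H = (\<lambda>x. (sin (\<phi> x) - 1) / \<phi>' x)"
  define H' where "H' = (\<lambda>x. cos (\<phi> x) + (1 - sin (\<phi> x)) * \<phi>'' x / (\<phi>' x)\<^sup>2)"
  have nz: "\<phi>' x > 0" if "x \<in> {a..b}" for x using lam that by force
  have "(H' has_integral (H b - H a)) {a..b}"
  proof (rule fundamental_theorem_of_calculus)
    fix x assume x: "x \<in> {a..b}"
    have "(H has_real_derivative H' x) (at x)"
      unfolding H_def H'_def using nz[OF x]
      by (auto intro!: derivative_eq_intros d1[OF x] d2[OF x] simp: field_simps power2_eq_square)
    then show "(H has_vector_derivative H' x) (at x within {a..b})"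
      by (simp add: has_real_derivative_iff_has_vector_derivative[symmetric] has_field_derivative_at_within)
  qed fact
  moreover have "(\<lambda>x. cos (\<phi> x)) integrable_on {a..b}"
  proof (rule integrable_continuous_interval)
    have "continuous_on {a..b} \<phi>"
      using d1 by (meson DERIV_isCont continuous_at_imp_continuous_on)
    then show "continuous_on {a..b} (\<lambda>x. cos (\<phi> x))" by (intro continuous_intros)
  qed
  moreover have "cos (\<phi> x) \<le> H' x" if "x \<in> {a..b}" for x
    using pos[OF that] by (simp add: H'_def)
  ultimately have 1: "integral {a..b} (\<lambda>x. cos (\<phi> x)) \<le> H b - H a"
    using has_integral_le integrable_integral by blast
  have 2: "H b \<le> 0" using nz[of b] \<open>a \<le> b\<close> by (simp add: H_def divide_nonpos_pos)
  have 3: "- H a \<le> 2 / l"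
  proof -
    have "- H a = (1 - sin (\<phi> a)) / \<phi>' a" by (simp add: H_def minus_divide_left)
    also have "\<dots> \<le> 2 / l"
      using lam(1)[of a] lam(2) \<open>a \<le> b\<close> sin_ge_minus_one[of "\<phi> a"] by (intro frac_le) auto
    finally show ?thesis .
  qed
  from 1 2 3 show ?thesis by linarith
qed

text \<open>The derivative of the phase in \<open>c\<close> is, up to
  \<open>2 * pi * \<theta>\<close>, at least \<open>p powr c * (ln p - ln q)\<close>, hence at least
  \<open>p powr (c - 1) * (p - q)\<close>. The factor \<open>1 / pi\<close> gained at the end is
  dropped.\<close>

lemma integral_cos_powr_diff_le:
  fixes p q n :: nat
  assumes q: "q \<ge> 1" and pq: "q < p" and pn: "p \<le> n"
    and al: "0 < \<alpha>" "\<alpha> \<le> 1" "\<alpha> \<le> a" "a \<le> b" and \<theta>: "\<theta> > 0"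
  shows "integral {a..b} (\<lambda>c. cos (2 * pi * \<theta> * real p powr c - 2 * pi * \<theta> * real q powr c))
         \<le> real n powr (1 - \<alpha>) / \<theta> * (1 / (real p - real q))"
proof -
  define l where "l = 2 * pi * \<theta> * (real n powr (\<alpha> - 1) * (real p - real q))"
  have n: "n > 0" using assms by simp
  have l: "l > 0" using \<theta> pq n by (simp add: l_def)
  have "integral {a..b} (\<lambda>c. cos (2 * pi * \<theta> * real p powr c - 2 * pi * \<theta> * real q powr c)) \<le> 2 / l"
  proof (rule integral_cos_phase_le[where
        \<phi>' = "\<lambda>c. 2 * pi * \<theta> * (real p powr c * ln p - real q powr c * ln q)" and
        \<phi>'' = "\<lambda>c. 2 * pi * \<theta> * (real p powr c * (ln p)\<^sup>2 - real q powr c * (ln q)\<^sup>2)"])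
    fix c assume c: "c \<in> {a..b}"
    have c0: "c > 0" using c al by simp
    have qp: "real q powr c \<le> real p powr c" using pq c0 by (intro powr_mono2) auto
    have ln: "0 \<le> ln (real q)" "ln (real q) \<le> ln (real p)" using q pq by auto
    show "((\<lambda>c. 2 * pi * \<theta> * real p powr c - 2 * pi * \<theta> * real q powr c) has_real_derivative
        2 * pi * \<theta> * (real p powr c * ln p - real q powr c * ln q)) (at c)"
      using q pq by (auto intro!: derivative_eq_intros simp: algebra_simps)
    show "((\<lambda>c. 2 * pi * \<theta> * (real p powr c * ln p - real q powr c * ln q)) has_real_derivative
        2 * pi * \<theta> * (real p powr c * (ln p)\<^sup>2 - real q powr c * (ln q)\<^sup>2)) (at c)"
      using q pq by (auto intro!: derivative_eq_intros simp: algebra_simps power2_eq_square)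
    have "real q powr c * (ln q)\<^sup>2 \<le> real p powr c * (ln p)\<^sup>2"
      using qp ln by (intro mult_mono power_mono) auto
    then show "0 \<le> 2 * pi * \<theta> * (real p powr c * (ln p)\<^sup>2 - real q powr c * (ln q)\<^sup>2)"
      using \<theta> by simp
    have "1 - real q / real p \<le> ln (real p) - ln (real q)"
      using ln_le_minus_one[of "real q / real p"] q pq by (simp add: ln_div)
    moreover have "1 - real q / real p = (real p - real q) / real p"
      using pq by (simp add: field_simps)
    ultimately have ld: "(real p - real q) / real p \<le> ln (real p) - ln (real q)" by simp
    \<comment> \<open>The exponent is not positive because \<open>\<alpha> \<le> 1\<close>, so
      replacing \<open>p\<close> by the larger \<open>n\<close> lowers the value and makes the bound
      uniform in \<open>p\<close>.\<close>
    have "real n powr (\<alpha> - 1) \<le> real p powr (\<alpha> - 1)"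
      using pn pq al by (intro powr_mono2') auto
    also have "\<dots> \<le> real p powr (c - 1)" using c al pq by (intro powr_mono) auto
    finally have "real n powr (\<alpha> - 1) * (real p - real q) \<le> real p powr (c - 1) * (real p - real q)"
      using pq by (intro mult_right_mono) auto
    also have "\<dots> = real p powr c * ((real p - real q) / real p)"
      using pq by (simp add: powr_diff)
    also have "\<dots> \<le> real p powr c * (ln (real p) - ln (real q))"
      using ld by (intro mult_left_mono) auto
    also have "\<dots> \<le> real p powr c * ln p - real q powr c * ln q"
      using mult_right_mono[OF qp ln(1)] by (simp add: algebra_simps)
    finally show "l \<le> 2 * pi * \<theta> * (real p powr c * ln p - real q powr c * ln q)"
      using \<theta> unfolding l_def by (intro mult_left_mono) auto
  qed (use al l in auto)
  also have "2 / l = (1 / pi) * (real n powr (1 - \<alpha>) / \<theta> * (1 / (real p - real q)))"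
  proof -
    have "real n powr (1 - \<alpha>) = 1 / real n powr (\<alpha> - 1)"
      using powr_minus_divide[of "real n" "\<alpha> - 1"] by simp
    then show ?thesis by (simp add: l_def)
  qed
  also have "\<dots> \<le> 1 * (real n powr (1 - \<alpha>) / \<theta> * (1 / (real p - real q)))"
    using pi_gt3 \<theta> pq by (intro mult_right_mono) auto
  finally show ?thesis by simp
qed

lemma harm_le_1_plus_ln: "n \<ge> 1 \<Longrightarrow> harm n \<le> 1 + ln (real n)"
  using euler_mascheroni_sequence_decreasing[of 1 n] by (simp add: harm_def)

lemma sum_inverse_dist_le:
  fixes p n :: nat
  assumes "p \<in> {1..n}"
  shows "(\<Sum>q\<in>{1..n}-{p}. 1 / \<bar>real p - real q\<bar>) \<le> 2 * (1 + ln n)"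
proof -
  have "(\<Sum>q\<in>{1..n}-{p}. 1 / \<bar>real p - real q\<bar>)
      = (\<Sum>q\<in>{1..<p}. 1 / \<bar>real p - real q\<bar>) + (\<Sum>q\<in>{p<..n}. 1 / \<bar>real p - real q\<bar>)"
    using assms by (subst sum.union_disjoint[symmetric]) (auto intro!: sum.cong)
  also have "(\<Sum>q\<in>{1..<p}. 1 / \<bar>real p - real q\<bar>) = (\<Sum>j\<in>{1..<p}. 1 / real j)"
    by (rule sum.reindex_bij_witness[of _ "\<lambda>j. p - j" "\<lambda>q. p - q"]) (auto simp: of_nat_diff)
  also have "\<dots> \<le> harm n"
    unfolding harm_def using assms by (auto simp: inverse_eq_divide intro!: sum_mono2)
  also have "(\<Sum>q\<in>{p<..n}. 1 / \<bar>real p - real q\<bar>) = (\<Sum>j\<in>{1..n-p}. 1 / real j)"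
    by (rule sum.reindex_bij_witness[of _ "\<lambda>j. p + j" "\<lambda>q. q - p"]) (auto simp: of_nat_diff)
  also have "\<dots> \<le> harm n"
    unfolding harm_def using assms by (auto simp: inverse_eq_divide intro!: sum_mono2)
  finally show ?thesis using harm_le_1_plus_ln[of n] assms by simp
qed

section \<open>Mean values of the exponential sums\<close>

definition expsum :: "nat set \<Rightarrow> real \<Rightarrow> real \<Rightarrow> real" where
  "expsum P \<theta> c = norm (\<Sum>p\<in>P. cis (2 * pi * \<theta> * real p powr c))"

lemma expsum_nonneg: "expsum P \<theta> c \<ge> 0"
  by (simp add: expsum_def)

lemma continuous_on_expsum:
  assumes "P \<subseteq> {1..n}"
  shows "continuous_on A (expsum P \<theta>)"
  unfolding expsum_def using assms
  by (intro continuous_intros) auto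

text \<open>The diagonal contributes \<open>b - a\<close> for each \<open>p\<close>. Off the
  diagonal the integrals decay like \<open>1 / \<bar>p - q\<bar>\<close>, and summing this over
  \<open>q\<close> costs only a logarithm.\<close>

lemma integral_expsum_squared_le:
  assumes P: "P \<subseteq> {1..n}" and n: "n \<ge> 1"
    and al: "0 < \<alpha>" "\<alpha> \<le> 1" "\<alpha> \<le> a" "a \<le> b" and \<theta>: "\<theta> > 0"
  shows "integral {a..b} (\<lambda>c. (expsum P \<theta> c)\<^sup>2)
         \<le> (b - a) * n + 2 * real n powr (2 - \<alpha>) * (1 + ln n) / \<theta>"
proof -
  let ?f = "\<lambda>p q c. cos (2 * pi * \<theta> * real p powr c - 2 * pi * \<theta> * real q powr c)"
  let ?B = "real n powr (1 - \<alpha>) / \<theta>"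
  have fin: "finite P" using P finite_subset by blast
  have cont: "continuous_on {a..b} (?f p q)" if "p \<in> P" "q \<in> P" for p q
    using P that by (intro continuous_intros) auto
  have int: "?f p q integrable_on {a..b}" if "p \<in> P" "q \<in> P" for p q
    using cont[OF that] by (rule integrable_continuous_interval)
  have le: "integral {a..b} (?f p q) \<le> ?B * (1 / \<bar>real p - real q\<bar>)" if "p \<in> P" "q \<in> P - {p}" for p q
  proof (cases "q < p")
    case True
    have "p \<in> {1..n}" "q \<in> {1..n}" using P that by auto
    then show ?thesis using integral_cos_powr_diff_le[of q p n \<alpha> a b \<theta>] True al \<theta> by auto
  next
    case False
    then have pq: "p < q" using that by simp
    have "?f p q = ?f q p" by (rule ext, subst cos_minus[symmetric]) simp
    moreover have "p \<in> {1..n}" "q \<in> {1..n}" using P that by auto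
    ultimately show ?thesis
      using integral_cos_powr_diff_le[of p q n \<alpha> a b \<theta>] al \<theta> pq by auto
  qed
  have "integral {a..b} (\<lambda>c. (expsum P \<theta> c)\<^sup>2) = integral {a..b} (\<lambda>c. \<Sum>p\<in>P. \<Sum>q\<in>P. ?f p q c)"
    unfolding expsum_def norm_sum_cis_squared ..
  also have "\<dots> = (\<Sum>p\<in>P. \<Sum>q\<in>P. integral {a..b} (?f p q))"
    using int fin by (subst integral_sum) (auto intro!: integrable_sum sum.cong integral_sum)
  also have "\<dots> \<le> (\<Sum>p\<in>P. (b - a) + ?B * (2 * (1 + ln n)))"
  proof (intro sum_mono)
    fix p assume p: "p \<in> P"
    have rem: "(\<Sum>q\<in>P. integral {a..b} (?f p q)) = integral {a..b} (?f p p) + (\<Sum>q\<in>P-{p}. integral {a..b} (?f p q))"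
      using p fin by (rule sum.remove[rotated])
    have diag: "integral {a..b} (?f p p) = b - a" using al by simp
    have "(\<Sum>q\<in>P-{p}. integral {a..b} (?f p q)) \<le> (\<Sum>q\<in>P-{p}. ?B * (1 / \<bar>real p - real q\<bar>))"
      using le p by (intro sum_mono) auto
    also have "\<dots> \<le> (\<Sum>q\<in>{1..n}-{p}. ?B * (1 / \<bar>real p - real q\<bar>))"
      using P \<theta> by (intro sum_mono2) auto
    also have "\<dots> = ?B * (\<Sum>q\<in>{1..n}-{p}. 1 / \<bar>real p - real q\<bar>)" by (simp only: sum_distrib_left)
    also have "\<dots> \<le> ?B * (2 * (1 + ln n))"
      using P p \<theta> by (intro mult_left_mono sum_inverse_dist_le) auto
    finally show "(\<Sum>q\<in>P. integral {a..b} (?f p q)) \<le> (b - a) + ?B * (2 * (1 + ln n))"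
      unfolding rem diag by (rule add_left_mono)
  qed
  also have "\<dots> = real (card P) * ((b - a) + ?B * (2 * (1 + ln n)))" by simp
  also have "\<dots> \<le> real n * ((b - a) + ?B * (2 * (1 + ln n)))"
    using card_mono[OF _ P] al \<theta> n by (intro mult_right_mono) (auto intro!: add_nonneg_nonneg)
  also have "\<dots> = (b - a) * n + 2 * (real n * real n powr (1 - \<alpha>)) * (1 + ln n) / \<theta>"
    by (simp add: algebra_simps add_divide_distrib)
  also have "real n * real n powr (1 - \<alpha>) = real n powr (2 - \<alpha>)"
    using n powr_add[of "real n" 1 "1 - \<alpha>"] by simp
  finally show ?thesis .
qed

text \<open>The mean value of \<open>expsum\<close> follows from its mean square by \<open>2 * u \<le> t + u\<^sup>2 / t\<close>.\<close>
lemma integral_expsum_le: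
  assumes P: "P \<subseteq> {1..n}" and n: "n \<ge> 1"
    and al: "0 < \<alpha>" "\<alpha> \<le> 1" "\<alpha> \<le> a" "a \<le> b" and \<theta>: "\<theta> > 0" and t: "t > 0"
  shows "integral {a..b} (expsum P \<theta>)
         \<le> (t * (b - a) + ((b - a) * n + 2 * real n powr (2 - \<alpha>) * (1 + ln n) / \<theta>) / t) / 2"
proof -
  have int2: "(\<lambda>c. (expsum P \<theta> c)\<^sup>2) integrable_on {a..b}"
    by (intro integrable_continuous_interval continuous_intros continuous_on_expsum[OF P])
  have "integral {a..b} (expsum P \<theta>) \<le> integral {a..b} (\<lambda>c. t / 2 + (expsum P \<theta> c)\<^sup>2 * (1 / (2 * t)))"
  proof (rule integral_le)
    show "expsum P \<theta> integrable_on {a..b}"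
      by (intro integrable_continuous_interval continuous_on_expsum[OF P])
    show "(\<lambda>c. t / 2 + (expsum P \<theta> c)\<^sup>2 * (1 / (2 * t))) integrable_on {a..b}"
      by (intro integrable_continuous_interval continuous_intros continuous_on_expsum[OF P])
    fix c
    have "0 \<le> (expsum P \<theta> c - t)\<^sup>2 / (2 * t)" using t by simp
    also have "\<dots> = (t / 2 + (expsum P \<theta> c)\<^sup>2 * (1 / (2 * t))) - expsum P \<theta> c"
      using t by (simp add: field_simps power2_eq_square)
    finally show "expsum P \<theta> c \<le> t / 2 + (expsum P \<theta> c)\<^sup>2 * (1 / (2 * t))" by simp
  qed
  also have "\<dots> = t * (b - a) / 2 + integral {a..b} (\<lambda>c. (expsum P \<theta> c)\<^sup>2) * (1 / (2 * t))"
  proof (subst integral_add)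
    show "(\<lambda>c. (expsum P \<theta> c)\<^sup>2 * (1 / (2 * t))) integrable_on {a..b}"
      by (intro integrable_on_mult_left int2)
  qed (use al in \<open>auto simp: integral_mult_left\<close>)
  also have "\<dots> \<le> t * (b - a) / 2 + ((b - a) * n + 2 * real n powr (2 - \<alpha>) * (1 + ln n) / \<theta>) * (1 / (2 * t))"
    using integral_expsum_squared_le[OF P n al \<theta>] t by (intro add_left_mono mult_right_mono) auto
  also have "\<dots> = (t * (b - a) + ((b - a) * n + 2 * real n powr (2 - \<alpha>) * (1 + ln n) / \<theta>) / t) / 2"
    using t by (simp add: field_simps)
  finally show ?thesis .
qed

text \<open>A shift by \<open>s\<close> only multiplies the exponential sum by a number of modulus
  \<open>1\<close>. So one error term serves all translates of the majorant.\<close>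

lemma abs_sum_cos_le_expsum:
  "\<bar>\<Sum>p\<in>P. cos (2 * pi * \<theta> * (real p powr c - s))\<bar> \<le> expsum P \<bar>\<theta>\<bar> c"
proof -
  have "(\<Sum>p\<in>P. cos (2 * pi * \<theta> * (real p powr c - s)))
      = (\<Sum>p\<in>P. cos (2 * pi * \<bar>\<theta>\<bar> * (real p powr c - s)))"
  proof (cases "\<theta> \<ge> 0")
    case False
    have "cos (2 * pi * \<theta> * (real p powr c - s)) = cos (2 * pi * \<bar>\<theta>\<bar> * (real p powr c - s))" for p
      using False by (subst cos_minus[symmetric]) simp
    then show ?thesis by simp
  qed simp
  also have "\<dots> = Re (cis (- 2 * pi * \<bar>\<theta>\<bar> * s) * (\<Sum>p\<in>P. cis (2 * pi * \<bar>\<theta>\<bar> * real p powr c)))"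
  proof -
    have "cos (2 * pi * \<bar>\<theta>\<bar> * (real p powr c - s))
        = Re (cis (- 2 * pi * \<bar>\<theta>\<bar> * s) * cis (2 * pi * \<bar>\<theta>\<bar> * real p powr c))" for p
      by (simp only: cis_mult cis.simps) (simp add: algebra_simps)
    then show ?thesis by (simp only: sum_distrib_left Re_sum)
  qed
  also have "\<bar>\<dots>\<bar> \<le> norm (cis (- 2 * pi * \<bar>\<theta>\<bar> * s) * (\<Sum>p\<in>P. cis (2 * pi * \<bar>\<theta>\<bar> * real p powr c)))"
    by (rule abs_Re_le_cmod)
  also have "\<dots> = expsum P \<bar>\<theta>\<bar> c" by (simp add: norm_mult expsum_def)
  finally show ?thesis .
qed

section \<open>Error terms of the sieve, pointwise and on average\<close>

definition fejer_error :: "nat set \<Rightarrow> nat \<Rightarrow> real \<Rightarrow> real" where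
  "fejer_error P D c =
     (\<Sum>h<D. \<Sum>k\<in>{..<D}-{h}. expsum P (\<bar>real h - real k\<bar> / D) c) / (real D)\<^sup>2"

text \<open>The \<open>D\<close> terms with \<open>h = k\<close> have frequency zero and give the
  main term; all others are exponential sums with frequencies that are nonzero multiples of
  \<open>1 / D\<close>.\<close>

lemma abs_sum_fejer_le:
  assumes "D > 0"
  shows "\<bar>(\<Sum>p\<in>P. fejer D (real p powr c - s)) - real (card P) / D\<bar> \<le> fejer_error P D c"
proof -
  let ?S = "\<lambda>h k. \<Sum>p\<in>P. cos (2 * pi * ((real h - real k) / D) * (real p powr c - s))"
  have "(\<Sum>p\<in>P. fejer D (real p powr c - s)) = (\<Sum>h<D. \<Sum>k<D. ?S h k) / (real D)\<^sup>2"
    unfolding fejer_def sum_divide_distrib[symmetric]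
    by (subst sum.swap, subst (2) sum.swap) (simp add: mult.assoc)
  also have "\<dots> = (\<Sum>h<D. real (card P) + (\<Sum>k\<in>{..<D}-{h}. ?S h k)) / (real D)\<^sup>2"
  proof -
    have "(\<Sum>k<D. ?S h k) = ?S h h + (\<Sum>k\<in>{..<D}-{h}. ?S h k)" if "h < D" for h
      using that by (intro sum.remove) auto
    then show ?thesis by simp
  qed
  also have "\<dots> = real (card P) / D + (\<Sum>h<D. \<Sum>k\<in>{..<D}-{h}. ?S h k) / (real D)\<^sup>2"
    using assms by (simp add: sum.distrib add_divide_distrib power2_eq_square)
  finally have "\<bar>(\<Sum>p\<in>P. fejer D (real p powr c - s)) - real (card P) / D\<bar>
      = \<bar>\<Sum>h<D. \<Sum>k\<in>{..<D}-{h}. ?S h k\<bar> / (real D)\<^sup>2" by simp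
  also have "\<dots> \<le> fejer_error P D c"
    unfolding fejer_error_def
  proof (rule divide_right_mono, rule order.trans[OF sum_abs], rule sum_mono,
         rule order.trans[OF sum_abs], rule sum_mono)
    fix h k :: nat
    show "\<bar>?S h k\<bar> \<le> expsum P (\<bar>real h - real k\<bar> / D) c"
      using abs_sum_cos_le_expsum[where P = P and \<theta> = "(real h - real k) / D" and c = c and s = s] by simp
  qed auto
  finally show ?thesis .
qed

text \<open>The factors \<open>d\<close> and \<open>e\<close> are the crude bounds for the Selberg
  weights.\<close>

definition sieve_error :: "nat \<Rightarrow> nat set \<Rightarrow> real \<Rightarrow> real" where
  "sieve_error R P c = (\<Sum>d=1..R. \<Sum>e=1..R. real d * real e * fejer_error P (lcm d e) c)"

lemma fejer_error_nonneg: "fejer_error P D c \<ge> 0"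
  unfolding fejer_error_def by (intro divide_nonneg_nonneg sum_nonneg expsum_nonneg) auto

lemma sieve_error_nonneg: "sieve_error R P c \<ge> 0"
  unfolding sieve_error_def by (intro sum_nonneg mult_nonneg_nonneg fejer_error_nonneg) auto

text \<open>The main terms \<open>card P / lcm d e\<close> of the kernels assemble to the quadratic
  form, whose bound supplies the saving of \<open>ln R\<close>.\<close>

lemma sum_selberg_majorant_le:
  assumes R: "R \<ge> 1"
  shows "(\<Sum>p\<in>P. selberg_majorant R (real p powr c - s))
         \<le> real (card P) * (2 / ln (real R + 1)) + sieve_error R P c"
proof -
  let ?l = "selberg_weight R"
  have "(\<Sum>p\<in>P. selberg_majorant R (real p powr c - s))
      = (\<Sum>d=1..R. \<Sum>e=1..R. ?l d * ?l e * (\<Sum>p\<in>P. fejer (lcm d e) (real p powr c - s)))"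
    unfolding selberg_majorant_def
    by (rule trans[OF sum.swap], rule sum.cong[OF refl], rule trans[OF sum.swap], simp only: sum_distrib_left)
  also have "\<dots> \<le> (\<Sum>d=1..R. \<Sum>e=1..R. real (card P) * (?l d * ?l e / real (lcm d e)) +
                      real d * real e * fejer_error P (lcm d e) c)"
  proof (intro sum_mono)
    fix d e assume de: "d \<in> {1..R}" "e \<in> {1..R}"
    let ?x = "(\<Sum>p\<in>P. fejer (lcm d e) (real p powr c - s)) - real (card P) / real (lcm d e)"
    have "lcm d e > 0" using de by (simp add: lcm_pos_nat)
    then have "\<bar>?x\<bar> \<le> fejer_error P (lcm d e) c" by (rule abs_sum_fejer_le)
    then have "\<bar>?l d\<bar> * \<bar>?l e\<bar> * \<bar>?x\<bar> \<le> real d * real e * fejer_error P (lcm d e) c"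
      by (intro mult_mono abs_selberg_weight_le) auto
    then have "?l d * ?l e * ?x \<le> real d * real e * fejer_error P (lcm d e) c"
      by (metis abs_mult abs_le_D1)
    then show "?l d * ?l e * (\<Sum>p\<in>P. fejer (lcm d e) (real p powr c - s))
       \<le> real (card P) * (?l d * ?l e / real (lcm d e)) + real d * real e * fejer_error P (lcm d e) c"
      by (simp add: algebra_simps)
  qed
  also have "\<dots> = real (card P) * (\<Sum>d=1..R. \<Sum>e=1..R. ?l d * ?l e / real (lcm d e)) + sieve_error R P c"
    by (simp only: sum.distrib sum_distrib_left sieve_error_def)
  also have "\<dots> \<le> real (card P) * (2 / ln (real R + 1)) + sieve_error R P c"
    using selberg_quadratic_form[OF R] by (intro add_right_mono mult_left_mono) auto
  finally show ?thesis .
qed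

lemma continuous_on_fejer_error:
  assumes "P \<subseteq> {1..n}"
  shows "continuous_on A (fejer_error P D)"
  unfolding fejer_error_def divide_inverse
  by (intro continuous_intros continuous_on_expsum[OF assms])

lemma continuous_on_sieve_error:
  assumes "P \<subseteq> {1..n}"
  shows "continuous_on A (sieve_error R P)"
  unfolding sieve_error_def
  by (intro continuous_intros continuous_on_fejer_error[OF assms])

text \<open>As \<open>lcm d e \<le> R ^ 2\<close>, all frequencies that occur are at least
  \<open>1 / R ^ 2\<close>, which gives the inner \<open>R ^ 2\<close>. The outer
  \<open>R ^ 4\<close> counts \<open>R ^ 2\<close> pairs of moduli with coefficients up to
  \<open>R ^ 2\<close>.\<close>

lemma integral_sieve_error_le:
  assumes P: "P \<subseteq> {1..n}" and n: "n \<ge> 1"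
    and al: "0 < \<alpha>" "\<alpha> \<le> 1" "\<alpha> \<le> a" "a \<le> b" and t: "t > 0"
  shows "integral {a..b} (sieve_error R P)
         \<le> real R ^ 4 * (t * (b - a) + ((b - a) * n + 2 * real n powr (2 - \<alpha>) * (1 + ln n) * real R ^ 2) / t) / 2"
proof -
  define B where "B = (t * (b - a) + ((b - a) * n + 2 * real n powr (2 - \<alpha>) * (1 + ln n) * real R ^ 2) / t) / 2"
  have ln: "1 + ln (real n) \<ge> 0" using n by simp
  have B0: "B \<ge> 0" using t al ln by (simp add: B_def)
  have e: "integral {a..b} (expsum P \<theta>) \<le> B" if "\<theta> \<ge> 1 / real R ^ 2" "R > 0" for \<theta>
  proof -
    have "1 / real R ^ 2 > 0" using that by simp
    then have th: "\<theta> > 0" using that by linarith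
    have "1 / \<theta> \<le> real R ^ 2" using that th by (simp add: field_simps)
    then have "2 * real n powr (2 - \<alpha>) * (1 + ln n) * (1 / \<theta>) \<le> 2 * real n powr (2 - \<alpha>) * (1 + ln n) * real R ^ 2"
      using ln by (intro mult_left_mono) auto
    then have "(t * (b - a) + ((b - a) * n + 2 * real n powr (2 - \<alpha>) * (1 + ln n) / \<theta>) / t) / 2 \<le> B"
      unfolding B_def using t by (intro divide_right_mono add_left_mono) auto
    with integral_expsum_le[OF P n al th t] show ?thesis by linarith
  qed
  have int: "expsum P \<theta> integrable_on {a..b}" for \<theta>
    by (intro integrable_continuous_interval continuous_on_expsum[OF P])
  have f: "integral {a..b} (fejer_error P D) \<le> B" if D: "0 < D" "D \<le> R ^ 2" "R > 0" for D
  proof -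
    have "integral {a..b} (fejer_error P D) 
        = (\<Sum>h<D. \<Sum>k\<in>{..<D}-{h}. integral {a..b} (expsum P (\<bar>real h - real k\<bar> / D))) / (real D)\<^sup>2"
      unfolding fejer_error_def using int
      by (simp add: integral_sum integrable_sum)
    also have "\<dots> \<le> (\<Sum>h<D. \<Sum>k\<in>{..<D}-{h}. B) / (real D)\<^sup>2"
    proof (intro divide_right_mono sum_mono e)
      fix h k assume "h \<in> {..<D}" "k \<in> {..<D}-{h}"
      then have "1 \<le> \<bar>real h - real k\<bar>" by auto
      moreover have "real D \<le> real R ^ 2" using D by (metis of_nat_le_iff of_nat_power)
      ultimately show "1 / real R ^ 2 \<le> \<bar>real h - real k\<bar> / D"
        using D by (intro frac_le) auto
    qed (use D in auto)
    \<comment> \<open>Restoring the diagonal makes the number of terms exactly \<open>D ^ 2\<close>,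
      which cancels the normalization.\<close>
    also have "\<dots> \<le> (\<Sum>h<D. \<Sum>k\<in>{..<D}. B) / (real D)\<^sup>2"
      using B0 by (intro divide_right_mono sum_mono sum_mono2) auto
    also have "\<dots> = B" using D by (simp add: power2_eq_square)
    finally show ?thesis .
  qed
  have intf: "fejer_error P D integrable_on {a..b}" for D
    by (intro integrable_continuous_interval continuous_on_fejer_error[OF P])
  have "integral {a..b} (sieve_error R P)
      = (\<Sum>d=1..R. \<Sum>e=1..R. real d * real e * integral {a..b} (fejer_error P (lcm d e)))"
    unfolding sieve_error_def using intf
    by (simp add: integral_sum integrable_sum integrable_on_mult_right)
  also have "\<dots> \<le> (\<Sum>d=1..R. \<Sum>e=1..R. real R * real R * B)"
  proof (intro sum_mono)
    fix d e assume de: "d \<in> {1..R}" "e \<in> {1..R}"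
    have D0: "lcm d e > 0" using de by (simp add: lcm_pos_nat)
    have "lcm d e \<le> d * e" using de by (intro dvd_imp_le) (auto simp: lcm_least)
    also have "\<dots> \<le> R * R" using de by (intro mult_mono) auto
    finally have "integral {a..b} (fejer_error P (lcm d e)) \<le> B"
      using de by (intro f D0) (auto simp: power2_eq_square)
    moreover have "0 \<le> integral {a..b} (fejer_error P (lcm d e))"
      by (intro integral_nonneg intf fejer_error_nonneg)
    ultimately show "real d * real e * integral {a..b} (fejer_error P (lcm d e)) \<le> real R * real R * B"
      using de by (intro mult_mono) auto
  qed
  also have "\<dots> = real R ^ 4 * B" by (simp add: power4_eq_xxxx)
  finally show ?thesis by (simp add: B_def)
qed

section \<open>Estimates of Chebyshev and Mertens\<close>

definition primes_le :: "nat \<Rightarrow> nat set" where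
  "primes_le n = {p. prime p \<and> p \<le> n}"

lemma finite_primes_le [simp]: "finite (primes_le n)"
  by (rule finite_subset[of _ "{..n}"]) (auto simp: primes_le_def)

lemma primes_le_subset: "primes_le n \<subseteq> {1..n}"
  by (auto simp: primes_le_def dest: prime_gt_0_nat)

lemma prod_primes_dvd:
  fixes m :: nat
  assumes "finite A" "\<And>p. p \<in> A \<Longrightarrow> prime p" "\<And>p. p \<in> A \<Longrightarrow> p dvd m"
  shows "\<Prod>A dvd m"
  using assms
proof (induction A rule: finite_induct)
  case (insert p A)
  have "coprime p (\<Prod>A)"
    using insert by (intro prod_coprime_right) (auto intro!: primes_coprime)
  then show ?case using insert by (simp add: divides_mult)
qed auto

lemma central_binomial_odd_le: "(2 * m + 1 choose m) \<le> 4 ^ m"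
proof -
  have "(2 * m + 1 choose m) + (2 * m + 1 choose Suc m) = (\<Sum>k\<in>{m, Suc m}. 2 * m + 1 choose k)"
    by simp
  also have "\<dots> \<le> (\<Sum>k\<le>2 * m + 1. 2 * m + 1 choose k)"
    by (intro sum_mono2) auto
  also have "\<dots> = 2 * 4 ^ m"
    by (subst choose_row_sum) (simp add: power_mult)
  also have "(2 * m + 1 choose Suc m) = (2 * m + 1 choose m)"
    by (subst binomial_symmetric) auto
  finally show ?thesis by simp
qed

text \<open>Erdos' argument: for \<open>n = 2 * m + 1\<close> the primes in
  \<open>(m + 1, n]\<close> divide \<open>n choose m\<close>, which is at most \<open>4 ^ m\<close>;
  the smaller primes are covered by induction. An even \<open>n > 2\<close> adds no prime.\<close>

lemma prod_primes_le: "\<Prod>(primes_le n) \<le> 4 ^ n"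
proof (induction n rule: less_induct)
  case (less n)
  consider "n \<le> 1" | "n = 2" | "n > 2" "even n" | m where "n = 2 * m + 1" "m \<ge> 1"
  proof -
    have "\<exists>m. n = 2 * m + 1 \<and> m \<ge> 1" if "odd n" "n > 2" using that by (auto elim!: oddE)
    moreover have "n \<le> 1 \<or> n = 2 \<or> n > 2" by linarith
    ultimately show ?thesis using that by blast
  qed
  then show ?case
  proof cases
    case 1
    then have "primes_le n = {}" by (auto simp: primes_le_def dest: prime_gt_1_nat)
    then show ?thesis by simp
  next
    case 2
    then have "primes_le n = {2}" by (auto simp: primes_le_def dest: prime_gt_1_nat)
    then show ?thesis using 2 by simp
  next
    case 3
    have "primes_le n = primes_le (n - 1)"
    proof (intro equalityI subsetI)
      fix p assume "p \<in> primes_le n"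
      then have p: "prime p" "p \<le> n" by (auto simp: primes_le_def)
      then have "p \<noteq> n" using 3 prime_odd_nat[of p] by auto
      then show "p \<in> primes_le (n - 1)" using p by (simp add: primes_le_def)
    qed (auto simp: primes_le_def)
    then have "\<Prod>(primes_le n) \<le> 4 ^ (n - 1)" using less[of "n - 1"] 3 by simp
    also have "\<dots> \<le> 4 ^ n" by (intro power_increasing) auto
    finally show ?thesis .
  next
    case (4 m)
    let ?A = "{p. prime p \<and> m + 1 < p \<and> p \<le> n}"
    have fin: "finite ?A" by (rule finite_subset[of _ "{..n}"]) auto
    have "\<Prod>?A dvd (n choose m)"
    proof (rule prod_primes_dvd[OF fin])
      fix p assume p: "p \<in> ?A"
      have "p dvd fact n" using p by (simp add: prime_dvd_fact_iff)
      also have "fact n = fact m * fact (n - m) * (n choose m)"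
        by (rule binomial_fact_lemma[symmetric]) (use 4 in simp)
      finally have "p dvd fact m \<or> p dvd fact (n - m) \<or> p dvd (n choose m)"
        using p by (auto simp: prime_dvd_mult_iff)
      then show "p dvd (n choose m)" using p 4 by (auto simp: prime_dvd_fact_iff simp del: fact_Suc)
    qed auto
    then have "\<Prod>?A \<le> (n choose m)" using 4 by (intro dvd_imp_le) auto
    also have "\<dots> \<le> 4 ^ m" using central_binomial_odd_le[of m] 4 by simp
    finally have A: "\<Prod>?A \<le> 4 ^ m" .
    have "primes_le n = primes_le (m + 1) \<union> ?A" using 4 by (auto simp: primes_le_def)
    then have "\<Prod>(primes_le n) = \<Prod>(primes_le (m + 1)) * \<Prod>?A"
      using fin by (simp only:) (intro prod.union_disjoint, auto simp: primes_le_def)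
    also have "\<dots> \<le> 4 ^ (m + 1) * 4 ^ m"
      using less[of "m + 1"] 4 A by (intro mult_mono) auto
    also have "\<dots> = 4 ^ n" using 4 by (simp add: power_add[symmetric])
    finally show ?thesis .
  qed
qed

lemma sum_ln_primes_le: "(\<Sum>p\<in>primes_le n. ln (real p)) \<le> real n * ln 4"
proof -
  have "(\<Sum>p\<in>primes_le n. ln (real p)) = ln (real (\<Prod>(primes_le n)))"
  proof -
    have "real p > 0" if "p \<in> primes_le n" for p
      using that by (simp add: primes_le_def prime_gt_0_nat)
    then show ?thesis unfolding of_nat_prod by (intro ln_prod[symmetric]) auto
  qed
  also have "\<dots> \<le> ln (real (4 ^ n))"
  proof (subst ln_le_cancel_iff)
    have "\<Prod>(primes_le n) > 0" by (intro prod_pos) (auto simp: primes_le_def prime_gt_0_nat)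
    then show "real (\<Prod>(primes_le n)) > 0" by (simp only: of_nat_0_less_iff)
    show "real (\<Prod>(primes_le n)) \<le> real (4 ^ n)" using prod_primes_le by (simp only: of_nat_le_iff)
  qed auto
  also have "\<dots> = real n * ln 4" by (simp add: ln_realpow)
  finally show ?thesis .
qed

text \<open>Primes up to \<open>sqrt n\<close> are few, and each larger one contributes at least
  \<open>ln n / 2\<close> to the sum of logarithms.\<close>

lemma card_primes_le_upper:
  assumes n: "n \<ge> 2"
  shows "real (card (primes_le n)) \<le> (2 + 2 * ln 4) * real n / ln n"
proof -
  let ?s = "sqrt (real n)"
  let ?A = "{p \<in> primes_le n. real p \<le> ?s}" and ?B = "{p \<in> primes_le n. real p > ?s}"
  have ln: "ln (real n) > 0" using n by simp
  have "card (primes_le n) = card (?A \<union> ?B)" by (intro arg_cong[of _ _ card]) auto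
  then have "card (primes_le n) = card ?A + card ?B" by (subst (asm) card_Un_disjoint) auto
  moreover have "real (card ?A) \<le> ?s"
  proof -
    have "?A \<subseteq> {1..nat \<lfloor>?s\<rfloor>}" using primes_le_subset[of n] by (auto simp: le_nat_floor)
    then have "card ?A \<le> card {1..nat \<lfloor>?s\<rfloor>}" by (intro card_mono) auto
    then have "card ?A \<le> nat \<lfloor>?s\<rfloor>" by simp
    then have "real (card ?A) \<le> real (nat \<lfloor>?s\<rfloor>)" by (simp only: of_nat_le_iff)
    also have "\<dots> \<le> ?s" by (rule of_nat_floor) simp
    finally show ?thesis .
  qed
  moreover have "?s \<le> 2 * real n / ln n"
  proof -
    have "ln (real n) = 2 * ln ?s" using n by (simp add: ln_sqrt)
    also have "\<dots> \<le> 2 * ?s" using ln_bound[of ?s] n by simp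
    finally have "ln (real n) * ?s \<le> 2 * ?s * ?s" by (rule mult_right_mono) simp
    also have "2 * ?s * ?s = 2 * real n" by simp
    finally show ?thesis using ln by (simp add: field_simps)
  qed
  moreover have "real (card ?B) \<le> 2 * ln 4 * real n / ln n"
  proof -
    have "real (card ?B) * (ln n / 2) = (\<Sum>p\<in>?B. ln ?s)" using n by (simp add: ln_sqrt)
    also have "\<dots> \<le> (\<Sum>p\<in>?B. ln (real p))"
    proof (intro sum_mono)
      fix p assume "p \<in> ?B"
      then have "?s < real p" by simp
      moreover have "?s > 0" using n by simp
      ultimately show "ln ?s \<le> ln (real p)" by (subst ln_le_cancel_iff; linarith)
    qed
    also have "\<dots> \<le> (\<Sum>p\<in>primes_le n. ln (real p))"
      by (intro sum_mono2) (auto simp: primes_le_def dest: prime_ge_1_nat)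
    also have "\<dots> \<le> real n * ln 4" by (rule sum_ln_primes_le)
    finally show ?thesis using ln by (simp add: field_simps)
  qed
  ultimately have "real (card (primes_le n)) \<le> 2 * real n / ln n + 2 * ln 4 * real n / ln n"
    by linarith
  then show ?thesis by (simp add: distrib_right add_divide_distrib)
qed

section \<open>Mertens' estimates from the factorization of \<open>fact n\<close>\<close>

lemma card_multiples_le: "d > 0 \<Longrightarrow> card {m \<in> {1..n}. d dvd m} = n div d"
proof -
  assume d: "d > 0"
  have "{m \<in> {1..n}. d dvd m} = (\<lambda>j. d * j) ` {1..n div d}"
  proof (intro equalityI subsetI)
    fix m assume m: "m \<in> {m \<in> {1..n}. d dvd m}"
    then obtain j where "m = d * j" by blast
    with m d show "m \<in> (\<lambda>j. d * j) ` {1..n div d}"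
      by (auto simp: less_eq_div_iff_mult_less_eq mult.commute intro!: imageI Suc_leI Nat.gr0I)
  qed (use d in \<open>auto simp: less_eq_div_iff_mult_less_eq mult.commute intro!: Suc_leI Nat.gr0I\<close>)
  then show ?thesis using d by (simp add: card_image inj_on_def)
qed

lemma ln_fact_le: "ln (fact n :: real) \<le> n * ln n"
proof (cases "n = 0")
  case False
  have "ln (fact n :: real) \<le> ln (real n ^ n)"
    using False by (subst ln_le_cancel_iff) (use fact_le_power[of n, where ?'a = real] in auto)
  then show ?thesis using False by (simp add: ln_realpow)
qed simp

lemma ln_fact_ge: "n \<ge> 1 \<Longrightarrow> ln (fact n :: real) \<ge> n * ln n - n"
proof (induction n rule: nat_induct_at_least)
  case (Suc n)
  have "ln (1 + 1 / real n) \<le> 1 / real n" using ln_add_one_self_le_self[of "1 / real n"] by simp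
  moreover have "ln (1 + 1 / real n) = ln (1 + real n) - ln n"
    using Suc ln_div[of "1 + real n" "real n"] by (simp add: add_divide_distrib add.commute)
  ultimately have "real n * (ln (1 + real n) - ln n) \<le> real n * (1 / real n)"
    by (intro mult_left_mono) auto
  then have "real n * ln (1 + real n) - real n * ln n \<le> 1"
    using Suc by (simp add: right_diff_distrib)
  moreover have "ln (fact (Suc n) :: real) = ln (1 + real n) + ln (fact n)"
    using Suc by (simp add: ln_mult)
  ultimately show ?case using Suc by (simp add: algebra_simps)
qed simp

lemma ln_fact_eq_sum: "ln (fact n :: real) = (\<Sum>m=1..n. ln (real m))"
  by (induction n) (auto simp: ln_mult)

text \<open>The product of the distinct primes dividing \<open>m\<close> is at most
  \<open>m\<close>, so the sum of \<open>ln p * (n div p)\<close> is at most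
  \<open>ln (fact n)\<close>. Removing the floors costs the sum of \<open>ln p\<close>, which
  Chebyshev's bound controls.\<close>

lemma mertens_upper:
  assumes n: "n \<ge> 1"
  shows "(\<Sum>p\<in>primes_le n. ln (real p) / real p) \<le> ln n + ln 4"
proof -
  have "(\<Sum>p\<in>primes_le n. ln (real p) * (real n / p - 1)) \<le> (\<Sum>p\<in>primes_le n. ln (real p) * real (n div p))"
  proof (intro sum_mono mult_left_mono)
    fix p assume p: "p \<in> primes_le n"
    have "real n / p < real (n div p) + 1"
      using floor_divide_of_nat_eq[of n p, where ?'a = real] floor_correct[of "real n / real p"] by simp
    then show "real n / p - 1 \<le> real (n div p)" by simp
    show "0 \<le> ln (real p)" using p by (auto simp: primes_le_def dest: prime_ge_1_nat)
  qed
  also have "\<dots> = (\<Sum>p\<in>primes_le n. \<Sum>m | m \<in> {1..n} \<and> p dvd m. ln (real p))"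
  proof (intro sum.cong refl)
    fix p assume "p \<in> primes_le n"
    then have "p > 0" by (simp add: primes_le_def prime_gt_0_nat)
    then show "ln (real p) * real (n div p) = (\<Sum>m | m \<in> {1..n} \<and> p dvd m. ln (real p))"
      using card_multiples_le[of p n] by simp
  qed
  also have "\<dots> = (\<Sum>m=1..n. \<Sum>p | p \<in> primes_le n \<and> p dvd m. ln (real p))"
    by (rule sum.swap_restrict) auto
  also have "\<dots> \<le> (\<Sum>m=1..n. ln (real m))"
  proof (intro sum_mono)
    fix m assume m: "m \<in> {1..n}"
    let ?A = "{p. p \<in> primes_le n \<and> p dvd m}"
    have fin: "finite ?A" by (rule finite_subset[of _ "primes_le n"]) auto
    have pos: "p > 0" if "p \<in> ?A" for p using that by (auto simp: primes_le_def prime_gt_0_nat)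
    have "\<Prod>?A dvd m" by (rule prod_primes_dvd[OF fin]) (auto simp: primes_le_def)
    then have "\<Prod>?A \<le> m" using m by (intro dvd_imp_le) auto
    moreover have "\<Prod>?A > 0" using pos by (intro prod_pos) auto
    ultimately have "ln (real (\<Prod>?A)) \<le> ln (real m)"
      by (subst ln_le_cancel_iff) (simp_all only: of_nat_0_less_iff of_nat_le_iff less_le_trans)
    moreover have "ln (real (\<Prod>?A)) = (\<Sum>p\<in>?A. ln (real p))"
      using pos fin by (simp only: of_nat_prod) (subst ln_prod, auto)
    ultimately show "(\<Sum>p\<in>?A. ln (real p)) \<le> ln (real m)" by simp
  qed
  also have "\<dots> \<le> real n * ln n" using ln_fact_le[of n] by (simp add: ln_fact_eq_sum)
  finally have "real n * (\<Sum>p\<in>primes_le n. ln (real p) / p) - (\<Sum>p\<in>primes_le n. ln (real p)) \<le> real n * ln n"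
    by (simp add: algebra_simps sum_subtractf sum_distrib_left)
  with sum_ln_primes_le[of n]
  have "real n * (\<Sum>p\<in>primes_le n. ln (real p) / p) \<le> real n * (ln n + ln 4)" by (simp add: algebra_simps)
  then show ?thesis using n by simp
qed

lemma summable_ln_over_square: "summable (\<lambda>m. ln (real m) / (real m * (real m - 1)))"
proof (rule summable_comparison_test_bigo)
  show "summable (\<lambda>m. norm (real m powr (- (3 / 2))))" by (simp add: summable_real_powr_iff)
  show "(\<lambda>m. ln (real m) / (real m * (real m - 1))) \<in> O(\<lambda>m. real m powr (- (3 / 2)))" by real_asymp
qed

lemma multiplicity_eq_card:
  assumes "prime p" "m \<in> {1..n}"
  shows "multiplicity p m = card {k \<in> {1..n}. p ^ k dvd m}"
proof -
  have iff: "p ^ k dvd m \<longleftrightarrow> k \<le> multiplicity p m" for k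
    using assms by (intro power_dvd_iff_le_multiplicity) (auto simp: prime_nat_iff)
  have "2 ^ multiplicity p m \<le> p ^ multiplicity p m"
    using assms by (intro power_mono) (auto dest: prime_ge_2_nat)
  also have "\<dots> \<le> m" using assms iff by (intro dvd_imp_le) auto
  finally have "multiplicity p m \<le> n"
    using assms(2) less_exp[of "multiplicity p m"] by (metis atLeastAtMost_iff le_trans less_imp_le)
  then have "{k \<in> {1..n}. p ^ k dvd m} = {1..multiplicity p m}" unfolding iff by auto
  then show ?thesis by simp
qed

lemma ln_eq_sum_multiplicity:
  assumes m: "m \<in> {1..n}"
  shows "ln (real m) = (\<Sum>p\<in>primes_le n. real (multiplicity p m) * ln (real p))"
proof -
  have "m = (\<Prod>p\<in>prime_factors m. p ^ multiplicity p m)"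
    using m prod_prime_factors[of m] by simp
  then have "ln (real m) = ln (real (\<Prod>p\<in>prime_factors m. p ^ multiplicity p m))" by simp
  also have "\<dots> = (\<Sum>p\<in>prime_factors m. ln (real p ^ multiplicity p m))"
  proof -
    have "real p ^ multiplicity p m > 0" if "p \<in> prime_factors m" for p
      using that by (simp add: prime_gt_0_nat in_prime_factors_iff)
    then show ?thesis unfolding of_nat_prod of_nat_power by (intro ln_prod) auto
  qed
  also have "\<dots> = (\<Sum>p\<in>prime_factors m. real (multiplicity p m) * ln (real p))"
    by (intro sum.cong refl ln_realpow)
  also have "\<dots> = (\<Sum>p\<in>primes_le n. real (multiplicity p m) * ln (real p))"
  proof (rule sum.mono_neutral_left)
    show "prime_factors m \<subseteq> primes_le n"
    proof
      fix p assume p: "p \<in> prime_factors m"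
      then have "p \<le> m" using m by (intro dvd_imp_le) auto
      then show "p \<in> primes_le n" using p m by (auto simp: primes_le_def)
    qed
    show "\<forall>p\<in>primes_le n - prime_factors m. real (multiplicity p m) * ln (real p) = 0"
      using m by (auto simp: primes_le_def in_prime_factors_iff not_dvd_imp_multiplicity_0)
  qed auto
  finally show ?thesis .
qed

text \<open>Here all prime powers dividing \<open>m \<le> n\<close> must be counted. The powers
  beyond the first contribute \<open>ln p / (p * (p - 1))\<close>, whose sum converges, and this
  enters the constant.\<close>

lemma mertens_lower:
  "\<exists>C\<ge>0. \<forall>n\<ge>1. (\<Sum>p\<in>primes_le n. ln (real p) / real p) \<ge> ln n - C"
proof -
  let ?g = "\<lambda>m. ln (real m) / (real m * (real m - 1))"
  have g0: "?g m \<ge> 0" for m by (cases "m = 0") auto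
  have "(\<Sum>p\<in>primes_le n. ln (real p) / real p) \<ge> ln n - (1 + suminf ?g)" if n: "n \<ge> 1" for n
  proof -
    have "real n * ln n - real n \<le> (\<Sum>m=1..n. ln (real m))"
      using ln_fact_ge[OF n] by (simp add: ln_fact_eq_sum)
    also have "\<dots> = (\<Sum>m=1..n. \<Sum>p\<in>primes_le n. real (multiplicity p m) * ln (real p))"
      by (intro sum.cong refl ln_eq_sum_multiplicity) auto
    also have "\<dots> = (\<Sum>p\<in>primes_le n. ln (real p) * (\<Sum>m=1..n. real (multiplicity p m)))"
      by (subst sum.swap) (simp add: sum_distrib_left mult.commute)
    also have "\<dots> \<le> (\<Sum>p\<in>primes_le n. ln (real p) * (real n * (1 / real p + 1 / (real p * (real p - 1)))))"
    proof (intro sum_mono mult_left_mono)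
      fix p assume p: "p \<in> primes_le n"
      then have pr: "prime p" and p2: "p \<ge> 2" by (auto simp: primes_le_def prime_ge_2_nat)
      show "0 \<le> ln (real p)" using p2 by simp
      have "(\<Sum>m=1..n. real (multiplicity p m)) = (\<Sum>m=1..n. \<Sum>k | k \<in> {1..n} \<and> p ^ k dvd m. 1)"
        by (intro sum.cong refl) (simp add: multiplicity_eq_card[OF pr, where n = n])
      also have "\<dots> = (\<Sum>k=1..n. \<Sum>m | m \<in> {1..n} \<and> p ^ k dvd m. 1)"
        by (rule sum.swap_restrict) auto
      also have "\<dots> = (\<Sum>k=1..n. real (n div p ^ k))"
        using p2 by (intro sum.cong refl) (simp add: card_multiples_le[simplified])
      also have "\<dots> \<le> (\<Sum>k=1..n. real n * (1 / real p) ^ k)"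
      proof (intro sum_mono)
        fix k
        have "real (n div p ^ k) \<le> real n / real (p ^ k)" by (rule of_nat_div_le_of_nat)
        then show "real (n div p ^ k) \<le> real n * (1 / real p) ^ k" by (simp add: power_divide)
      qed
      also have "\<dots> = real n * (\<Sum>k=1..n. (1 / real p) ^ k)" by (simp only: sum_distrib_left)
      also have "(\<Sum>k=1..n. (1 / real p) ^ k) \<le> 1 / real p + 1 / (real p * (real p - 1))"
      proof -
        have "(\<Sum>k=1..n. (1 / real p) ^ k) = ((1 / real p) - (1 / real p) ^ Suc n) / (1 - 1 / real p)"
          using p2 n by (subst sum_gp) auto
        also have "\<dots> \<le> (1 / real p) / (1 - 1 / real p)"
          using p2 by (intro divide_right_mono) auto
        also have "\<dots> = 1 / real p + 1 / (real p * (real p - 1))" using p2 by (simp add: field_simps)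
        finally show ?thesis .
      qed
      finally show "(\<Sum>m=1..n. real (multiplicity p m)) \<le> real n * (1 / real p + 1 / (real p * (real p - 1)))"
        by (simp add: mult_left_mono)
    qed
    also have "\<dots> = real n * ((\<Sum>p\<in>primes_le n. ln (real p) / real p) + (\<Sum>p\<in>primes_le n. ?g p))"
      by (simp add: sum_distrib_left sum.distrib[symmetric] algebra_simps)
    also have "\<dots> \<le> real n * ((\<Sum>p\<in>primes_le n. ln (real p) / real p) + suminf ?g)"
      by (intro mult_left_mono add_left_mono sum_le_suminf summable_ln_over_square) (use g0 in auto)
    finally have "real n * (ln n - 1) \<le> real n * ((\<Sum>p\<in>primes_le n. ln (real p) / real p) + suminf ?g)"
      by (simp add: right_diff_distrib)
    then show ?thesis using n by simp
  qed
  moreover have "1 + suminf ?g \<ge> 0" using suminf_nonneg[OF summable_ln_over_square] g0 by simp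
  ultimately show ?thesis by blast
qed

section \<open>Many primes along a sequence\<close>

text \<open>Partial summation; it is an inequality because \<open>ln (k + 1)\<close> is replaced by
  \<open>ln k\<close> in the difference of \<open>ln k / k\<close> and
  \<open>ln (k + 1) / (k + 1)\<close>.\<close>

lemma sum_primes_abel_le:
  "(\<Sum>p\<in>primes_le n. ln (real p) / real p) \<le>
     real (card (primes_le n)) * ln n / n + (\<Sum>k=1..<n. real (card (primes_le k)) * ln k / (real k * (real k + 1)))"
proof (induction n)
  case 0
  have "primes_le 0 = {}" by (auto simp: primes_le_def)
  then show ?case by simp
next
  case (Suc n)
  show ?case
  proof (cases "n = 0")
    case True
    have "primes_le (Suc 0) = {}" by (auto simp: primes_le_def dest: prime_gt_1_nat)
    then show ?thesis using True by simp
  next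
    case False
    let ?c = "\<lambda>n. real (card (primes_le n))"
    let ?i = "if prime (Suc n) then 1 else 0 :: real"
    have ins: "primes_le (Suc n) = (if prime (Suc n) then insert (Suc n) (primes_le n) else primes_le n)"
      by (auto simp: primes_le_def le_Suc_eq)
    have ni: "Suc n \<notin> primes_le n" by (simp add: primes_le_def)
    have 1: "(\<Sum>p\<in>primes_le (Suc n). ln (real p) / real p)
        = (\<Sum>p\<in>primes_le n. ln (real p) / real p) + ?i * (ln (real (Suc n)) / real (Suc n))"
      using ni by (simp add: ins)
    have 2: "?c (Suc n) = ?c n + ?i" using ni by (simp add: ins)
    have "ln (real n) / n - ln n / (real n + 1) = ln n / (real n * (real n + 1))"
      using False by (subst diff_frac_eq) (auto simp: right_diff_distrib distrib_left mult.commute)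
    then have "ln (real n) / n = ln n / (real n * (real n + 1)) + ln n / (real n + 1)" by linarith
    also have "ln (real n) / (real n + 1) \<le> ln (real (Suc n)) / (real n + 1)"
      using False by (intro divide_right_mono) auto
    finally have "?c n * (ln (real n) / n) \<le>
       ?c n * (ln n / (real n * (real n + 1)) + ln (real (Suc n)) / (real n + 1))"
      by (intro mult_left_mono) auto
    then have 3: "?c n * ln n / n \<le> ?c n * ln n / (real n * (real n + 1)) + ?c n * (ln (real (Suc n)) / real (Suc n))"
      by (simp add: distrib_left add.commute)
    have 4: "(\<Sum>k=1..<Suc n. ?c k * ln k / (real k * (real k + 1)))
       = (\<Sum>k=1..<n. ?c k * ln k / (real k * (real k + 1))) + ?c n * ln n / (real n * (real n + 1))"
      using False by (subst sum.atLeastLessThan_Suc) auto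
    have 5: "?c (Suc n) * ln (real (Suc n)) / real (Suc n)
        = ?c n * (ln (real (Suc n)) / real (Suc n)) + ?i * (ln (real (Suc n)) / real (Suc n))"
      unfolding 2 by (simp only: distrib_right add_divide_distrib times_divide_eq_right)
    show ?thesis using Suc 1 3 4 5 by linarith
  qed
qed

text \<open>An upper bound \<open>(1 - \<epsilon>) * n / ln n\<close> on the number of primes for all large \<open>n\<close> would
  contradict Mertens' estimate by partial summation.\<close>
lemma frequently_card_primes_le_ge:
  assumes e: "\<epsilon> > 0" "\<epsilon> < 1"
  shows "\<exists>n\<ge>N. real (card (primes_le n)) \<ge> (1 - \<epsilon>) * n / ln n"
proof (rule ccontr)
  assume "\<not> ?thesis"
  then have bd: "real (card (primes_le n)) \<le> (1 - \<epsilon>) * n / ln n" if "n \<ge> N" for n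
    using that by force
  obtain C where C: "\<And>n. n \<ge> 1 \<Longrightarrow> (\<Sum>p\<in>primes_le n. ln (real p) / real p) \<ge> ln n - C"
    using mertens_lower by blast
  define M where "M = max N 2"
  let ?h = "\<lambda>k. real (card (primes_le k)) * ln k / (real k * (real k + 1))"
  \<comment> \<open>The summands are the boundary term, the part of the sum below \<open>M\<close>
    where the assumed bound may fail, the excess of the harmonic sum over \<open>ln n\<close>, and
    Mertens' constant. None depends on \<open>n\<close>, so \<open>\<epsilon> * ln n \<le> K\<close>
    fails eventually.\<close>
  define K where "K = 1 + (\<Sum>k=1..<M. ?h k) + (1 - \<epsilon>) + C"
  have le: "ln n \<le> (1 - \<epsilon>) * ln n + K" if n: "n \<ge> M" for n :: nat
  proof -
    have bd': "real (card (primes_le k)) * ln k \<le> (1 - \<epsilon>) * k" if "k \<ge> M" for k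
      using bd[of k] that by (simp add: M_def field_simps)
    have "ln n - C \<le> (\<Sum>p\<in>primes_le n. ln (real p) / real p)" using C n by (simp add: M_def)
    also have "\<dots> \<le> real (card (primes_le n)) * ln n / n + (\<Sum>k=1..<n. ?h k)"
      by (rule sum_primes_abel_le)
    also have "real (card (primes_le n)) * ln n / n \<le> 1"
    proof -
      have "(1 - \<epsilon>) * real n \<le> 1 * real n" using e by (intro mult_right_mono) auto
      with bd'[OF n] have "real (card (primes_le n)) * ln n \<le> real n" by linarith
      then show ?thesis using n by (simp add: M_def)
    qed
    also have "(\<Sum>k=1..<n. ?h k) = (\<Sum>k=1..<M. ?h k) + (\<Sum>k=M..<n. ?h k)"
      using n by (subst sum.atLeastLessThan_concat) (auto simp: M_def)
    also have "(\<Sum>k=M..<n. ?h k) \<le> (\<Sum>k=M..<n. (1 - \<epsilon>) * (1 / real k))"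
    proof (intro sum_mono)
      fix k assume "k \<in> {M..<n}"
      then have k: "k \<ge> M" "k > 0" by (auto simp: M_def)
      have "?h k \<le> (1 - \<epsilon>) * k / (real k * (real k + 1))"
        using bd'[OF k(1)] by (intro divide_right_mono) auto
      also have "\<dots> = (1 - \<epsilon>) * (1 / (real k + 1))" using k by simp
      also have "\<dots> \<le> (1 - \<epsilon>) * (1 / real k)" using e k by (intro mult_left_mono divide_left_mono) auto
      finally show "?h k \<le> (1 - \<epsilon>) * (1 / real k)" .
    qed
    also have "\<dots> \<le> (\<Sum>k=1..n. (1 - \<epsilon>) * (1 / real k))"
      using e by (intro sum_mono2) (auto simp: M_def)
    also have "\<dots> = (1 - \<epsilon>) * harm n" by (simp add: sum_distrib_left harm_def inverse_eq_divide)
    also have "\<dots> \<le> (1 - \<epsilon>) * (1 + ln n)"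
      using e n euler_mascheroni_sequence_decreasing[of 1 n]
      by (intro mult_left_mono) (auto simp: M_def harm_def)
    finally show ?thesis by (simp add: K_def algebra_simps)
  qed
  have "filterlim (\<lambda>n. \<epsilon> * ln (real n)) at_top at_top" using e by real_asymp
  then have "eventually (\<lambda>n. \<epsilon> * ln (real n) > K) at_top" by (simp add: filterlim_at_top_dense)
  then have "eventually (\<lambda>n. \<epsilon> * ln (real n) > K \<and> n \<ge> M) at_top"
    by (intro eventually_conj eventually_ge_at_top)
  then obtain n where "\<epsilon> * ln (real n) > K" "n \<ge> M" by (auto simp: eventually_at_top_linorder)
  with le[of n] show False by (simp add: algebra_simps)
qed

section \<open>The measure of the exponents hitting a shifted prime\<close>

definition hits :: "int \<Rightarrow> nat \<Rightarrow> real set" where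
  "hits a p = {c. \<exists>q::nat. prime q \<and> \<lfloor>real p powr c\<rfloor> = int q + a}"

lemma sets_hits [measurable]: "hits a p \<in> sets lebesgue"
proof -
  have "hits a p = (\<Union>q\<in>{q. prime q}. {c. real_of_int (int q + a) \<le> real p powr c \<and> real p powr c < real_of_int (int q + a) + 1})"
    by (auto simp: hits_def floor_eq_iff)
  also have "\<dots> \<in> sets borel"
  proof (intro sets.countable_UN'')
    fix q :: nat
    have "{c \<in> space borel. real_of_int (int q + a) \<le> real p powr c \<and> real p powr c < real_of_int (int q + a) + 1} \<in> sets borel"
      by measurable
    then show "{c. real_of_int (int q + a) \<le> real p powr c \<and> real p powr c < real_of_int (int q + a) + 1} \<in> sets borel"
      by simp
  qed auto
  finally show ?thesis by (simp add: sets_completionI_sets)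
qed

text \<open>The exponents leading to a given \<open>q\<close> form the interval from
  \<open>log p (q + a)\<close> to \<open>log p (q + a + 1)\<close>, and
  \<open>ln (1 + 1 / x) \<ge> 1 / (x + 1)\<close> bounds its length. The intervals are disjoint
  since the floor determines \<open>q\<close>.\<close>

lemma measure_hits_ge_sum:
  assumes p: "p \<ge> 2" and a: "a \<ge> 1" and fin: "finite Q"
    and Q: "\<And>q. q \<in> Q \<Longrightarrow> prime q \<and> real p powr \<alpha> \<le> real q + a \<and> real q + a + 1 \<le> real p powr \<beta>"
  shows "(\<Sum>q\<in>Q. 1 / (real q + a + 1)) \<le> measure lebesgue (hits a p \<inter> {\<alpha>..\<beta>}) * ln p"
proof -
  define J where "J = (\<lambda>q::nat. {log p (real q + a) ..< log p (real q + a + 1)})"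
  have lnp: "ln (real p) > 0" using p by simp
  have J_iff: "\<lfloor>real p powr c\<rfloor> = int q + a" if "c \<in> J q" for c q
  proof -
    have "p powr (log p (real q + a)) \<le> p powr c" "p powr c < p powr (log p (real q + a + 1))"
      using that p by (auto simp: J_def)
    then show ?thesis using p a by (auto simp: floor_eq_iff)
  qed
  have sub: "(\<Union>q\<in>Q. J q) \<subseteq> hits a p \<inter> {\<alpha>..\<beta>}"
  proof safe
    fix q c assume q: "q \<in> Q" and c: "c \<in> J q"
    show "c \<in> hits a p" using J_iff[OF c] Q[OF q] by (auto simp: hits_def)
    have "\<alpha> = log p (p powr \<alpha>)" "\<beta> = log p (p powr \<beta>)" using p by auto
    moreover have "log p (p powr \<alpha>) \<le> log p (real q + a)" "log p (real q + a + 1) \<le> log p (p powr \<beta>)"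
      using Q[OF q] p a by (auto simp del: log_powr_cancel)
    ultimately have "\<alpha> \<le> log p (real q + a)" "log p (real q + a + 1) \<le> \<beta>" by auto
    then show "c \<in> {\<alpha>..\<beta>}" using c by (auto simp: J_def)
  qed
  have "(\<Sum>q\<in>Q. 1 / (real q + a + 1)) \<le> (\<Sum>q\<in>Q. measure lebesgue (J q) * ln p)"
  proof (intro sum_mono)
    fix q assume "q \<in> Q"
    define x where "x = real q + a"
    have x: "x > 0" using a by (simp add: x_def)
    have "1 - x / (x + 1) \<le> ln (x + 1) - ln x"
      using ln_le_minus_one[of "x / (x + 1)"] x by (simp add: ln_div)
    moreover have "1 - x / (x + 1) = 1 / (x + 1)" using x by (simp add: field_simps)
    moreover have "measure lebesgue (J q) * ln p = ln (x + 1) - ln x"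
    proof -
      have "log p x \<le> log p (x + 1)" using x p by simp
      then have "measure lebesgue (J q) = log p (x + 1) - log p x"
        unfolding J_def x_def by simp
      then show ?thesis using lnp by (simp add: log_def field_simps)
    qed
    ultimately show "1 / (real q + a + 1) \<le> measure lebesgue (J q) * ln p" by (simp add: x_def)
  qed
  also have "\<dots> = measure lebesgue (\<Union>q\<in>Q. J q) * ln p"
  proof -
    have "disjoint_family_on J Q"
      unfolding disjoint_family_on_def using J_iff by (metis disjoint_iff add_right_cancel of_nat_eq_iff)
    then have "measure lebesgue (\<Union>q\<in>Q. J q) = (\<Sum>q\<in>Q. measure lebesgue (J q))"
    proof (intro measure_finite_Union fin)
      have J: "J q \<in> lmeasurable" for q
        unfolding J_def by (rule bounded_set_imp_lmeasurable) auto
      show "J ` Q \<subseteq> sets lebesgue" using J by (auto intro: fmeasurableD)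
      show "emeasure lebesgue (J q) \<noteq> \<infinity>" for q using fmeasurableD2[OF J] by simp
    qed
    then show ?thesis by (simp add: sum_distrib_right)
  qed
  also have "\<dots> \<le> measure lebesgue (hits a p \<inter> {\<alpha>..\<beta>}) * ln p"
  proof (intro mult_right_mono measure_mono_fmeasurable sub)
    show "(\<Union>q\<in>Q. J q) \<in> sets lebesgue" using fin by (auto simp: J_def)
    show "hits a p \<inter> {\<alpha>..\<beta>} \<in> lmeasurable"
      by (intro fmeasurable_Int_fmeasurable[of "{\<alpha>..\<beta>}", simplified Int_commute]) auto
  qed (use lnp in auto)
  finally show ?thesis .
qed

text \<open>Mertens' estimate concerns \<open>ln q / q\<close>, so every \<open>ln q\<close> is
  bounded by the largest value \<open>\<beta> * ln p\<close>. This yields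
  \<open>(\<beta> - \<alpha>) / \<beta>\<close>, which is sharp enough because it will be applied to
  short intervals.\<close>

lemma eventually_measure_hits_ge:
  fixes \<alpha> \<beta> :: real
  assumes al: "0 < \<alpha>" "\<alpha> < \<beta>" and a: "a \<ge> 1" and e: "\<epsilon> > 0"
  shows "eventually (\<lambda>p::nat. measure lebesgue (hits a p \<inter> {\<alpha>..\<beta>}) * ln p \<ge> (\<beta> - \<alpha>) / \<beta> - \<epsilon>) at_top"
proof -
  obtain C where C: "C \<ge> 0" "\<And>n. n \<ge> 1 \<Longrightarrow> (\<Sum>p\<in>primes_le n. ln (real p) / real p) \<ge> ln n - C"
    using mertens_lower by blast
  define b where "b = real_of_int a + 1"
  define D where "D = C + ln 4"
  \<comment> \<open>\<open>f p\<close> is the lower bound the estimates below will produce: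
    \<open>D\<close> joins the two Mertens constants, and \<open>b / p powr \<alpha>\<close> pays
    for replacing \<open>q\<close> by \<open>q + a + 1\<close>.\<close>
  define f where "f = (\<lambda>p::nat. (ln (real p powr \<beta> - b - 1) - ln (real p powr \<alpha> + 1) - D) /
                         ((1 + b / real p powr \<alpha>) * (\<beta> * ln p)))"
  have b: "b > 0" using a by (simp add: b_def)
  have be: "\<beta> > 0" using al by simp
  have "f \<longlonglongrightarrow> (\<beta> - \<alpha>) / \<beta>"
    unfolding f_def using al be b by (real_asymp simp: field_simps)
  then have ev1: "eventually (\<lambda>p. f p > (\<beta> - \<alpha>) / \<beta> - \<epsilon>) at_top"
    using e by (intro order_tendstoD) auto
  have ev2: "eventually (\<lambda>p::nat. real p powr \<alpha> + 1 < real p powr \<beta> - b - 1) at_top"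
    using al be b by real_asymp
  from ev1 ev2 eventually_ge_at_top[of 2] show ?thesis
  proof eventually_elim
    case (elim p)
    \<comment> \<open>For primes \<open>q\<close> with \<open>u < q \<le> v\<close>, the whole
      interval of exponents belonging to \<open>q\<close> lies in
      \<open>[\<alpha>, \<beta>]\<close>.\<close>
    define u where "u = nat \<lceil>real p powr \<alpha>\<rceil>"
    define v where "v = nat \<lfloor>real p powr \<beta> - b\<rfloor>"
    define K where "K = 1 / ((1 + b / real p powr \<alpha>) * (\<beta> * ln p))"
    have pa: "real p powr \<alpha> > 0" using elim by simp
    have lnp: "ln (real p) > 0" using elim by simp
    have u: "real p powr \<alpha> \<le> u" "real u \<le> real p powr \<alpha> + 1"
      unfolding u_def using pa by linarith+
    have v: "real v \<le> real p powr \<beta> - b" "real p powr \<beta> - b - 1 \<le> real v"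
      unfolding v_def using elim pa by linarith+
    have uv: "u \<le> v" using u v elim by linarith
    have u1: "u \<ge> 1" using u pa by linarith
    have K0: "K \<ge> 0" using be b lnp pa by (simp add: K_def)
    let ?Q = "primes_le v - primes_le u"
    have "(\<beta> - \<alpha>) / \<beta> - \<epsilon> \<le> f p" using elim by simp
    also have "f p = K * (ln (real p powr \<beta> - b - 1) - ln (real p powr \<alpha> + 1) - D)"
      by (simp add: f_def K_def)
    also have "\<dots> \<le> K * (ln v - ln u - D)"
    proof -
      have "ln (real p powr \<beta> - b - 1) \<le> ln v" "ln u \<le> ln (real p powr \<alpha> + 1)"
        using u v u1 uv elim pa by (subst ln_le_cancel_iff; linarith)+
      then show ?thesis using K0 by (intro mult_left_mono) auto
    qed
    also have "\<dots> \<le> K * (\<Sum>q\<in>?Q. ln (real q) / real q)"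
    proof -
      have "primes_le u \<subseteq> primes_le v" using uv by (auto simp: primes_le_def)
      then have "(\<Sum>q\<in>?Q. ln (real q) / real q)
        = (\<Sum>q\<in>primes_le v. ln (real q) / real q) - (\<Sum>q\<in>primes_le u. ln (real q) / real q)"
        by (intro sum_diff) auto
      also have "\<dots> \<ge> ln v - ln u - D"
        using C(2)[of v] mertens_upper[of u] u1 uv by (simp add: D_def)
      finally show ?thesis using K0 by (intro mult_left_mono) auto
    qed
    also have "\<dots> = (\<Sum>q\<in>?Q. K * (ln (real q) / real q))" by (simp only: sum_distrib_left)
    also have "\<dots> \<le> (\<Sum>q\<in>?Q. 1 / (real q + a + 1))"
    proof (intro sum_mono)
      fix q assume "q \<in> ?Q"
      then have q: "u < q" "q \<le> v" by (auto simp: primes_le_def)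
      have q0: "real q > 0" using q by simp
      have "ln (real q) \<le> ln (real p powr \<beta>)"
        using q0 q v b by (subst ln_le_cancel_iff; linarith?)
      then have l: "ln (real q) \<le> \<beta> * ln p" by simp
      have "b / q \<le> b / real p powr \<alpha>" using q u pa b by (intro divide_left_mono mult_pos_pos) auto
      then have d: "(real q + b) / q \<le> 1 + b / real p powr \<alpha>" using q0 by (simp add: add_divide_distrib)
      have "K * (ln (real q) / real q) = (ln (real q) / (\<beta> * ln p)) * (1 / (1 + b / real p powr \<alpha>)) * (1 / q)"
        by (simp add: K_def)
      also have "\<dots> \<le> 1 * (1 / ((real q + b) / q)) * (1 / q)"
      proof (intro mult_mono)
        show "ln (real q) / (\<beta> * ln p) \<le> 1" using l be lnp by (simp add: divide_le_eq)
        have "(real q + b) / q > 0" using q0 b by simp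
        then show "1 / (1 + b / real p powr \<alpha>) \<le> 1 / ((real q + b) / q)"
          using d by (intro divide_left_mono mult_pos_pos) linarith+
      qed (use q0 b pa in auto)
      also have "\<dots> = 1 / (real q + a + 1)" using q0 by (simp add: b_def add_ac)
      finally show "K * (ln (real q) / real q) \<le> 1 / (real q + a + 1)" .
    qed
    also have "\<dots> \<le> measure lebesgue (hits a p \<inter> {\<alpha>..\<beta>}) * ln p"
    proof (rule measure_hits_ge_sum)
      fix q assume "q \<in> ?Q"
      then have q: "prime q" "u < q" "q \<le> v" by (auto simp: primes_le_def)
      then have "real u < real q" "real q \<le> real v" by auto
      then show "prime q \<and> real p powr \<alpha> \<le> real q + a \<and> real q + a + 1 \<le> real p powr \<beta>"
        using q u v a by (auto simp: b_def)
    qed (use elim a in auto)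
    finally show ?case .
  qed
qed

section \<open>Sieve upper bound and density points\<close>

text \<open>A weak form of Lebesgue's density theorem. Cover \<open>S\<close> by short
  nonoverlapping intervals inside an open \<open>T\<close> that exceeds \<open>S\<close> by little;
  if each of them had a substantial part outside \<open>S\<close>, then \<open>T - S\<close> would
  be too large.\<close>

lemma measurable_set_mostly_fills_interval:
  fixes S :: "real set"
  assumes S: "S \<in> sets lebesgue" "S \<subseteq> {L..U}" and pos: "measure lebesgue S > 0"
    and \<kappa>: "0 < \<kappa>" "\<kappa> \<le> 1" and \<eta>: "\<eta> > 0"
  obtains \<alpha> \<beta> where "\<alpha> < \<beta>" "\<beta> - \<alpha> \<le> \<eta>" "{\<alpha>..\<beta>} \<subseteq> {L..U}"
    "measure lebesgue ({\<alpha>..\<beta>} - S) \<le> \<kappa> * (\<beta> - \<alpha>)"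
proof -
  \<comment> \<open>Failure for all cells would give
    \<open>\<kappa> * (measure lebesgue S - e) < e\<close>, hence \<open>4 * e < 2 * e\<close> as
    \<open>\<kappa> \<le> 1\<close>.\<close>
  define e where "e = \<kappa> * measure lebesgue S / 4"
  have e: "e > 0" using pos \<kappa> by (simp add: e_def)
  have Sm: "S \<in> lmeasurable"
    using S bounded_subset[of "{L..U}" S] by (intro bounded_set_imp_lmeasurable) auto
  obtain T where T: "open T" "S \<subseteq> T" "T - S \<in> lmeasurable" "emeasure lebesgue (T - S) < ennreal e"
    using sets_lebesgue_outer_open[OF S(1) e] .
  have TS: "measure lebesgue (T - S) < e"
    using T(3,4) e by (simp add: emeasure_eq_measure2 ennreal_less_iff)
  have LU: "L < U"
  proof (rule ccontr)
    assume "\<not> L < U"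
    then have "S \<subseteq> {L}" using S(2) by auto
    then have "negligible S" by (rule negligible_subset[rotated]) simp
    then show False using pos by (simp add: negligible_imp_measure0)
  qed
  have "\<exists>r. \<forall>x\<in>T. r x > 0 \<and> ball x (r x) \<subseteq> T"
    using T(1) unfolding open_contains_ball by (rule bchoice)
  then obtain r where r: "\<And>x. x \<in> T \<Longrightarrow> r x > 0 \<and> ball x (r x) \<subseteq> T" by blast
  \<comment> \<open>Cells are tagged by points of \<open>S\<close>, hence of \<open>T\<close>, so
    each lies in \<open>T\<close> and in a ball of radius at most \<open>\<eta> / 2\<close>. The
    value off \<open>T\<close> only makes \<open>g\<close> a gauge.\<close>
  define g where "g = (\<lambda>x. if x \<in> T then ball x (min (r x) (\<eta> / 2)) else ball x 1)"
  have ga: "gauge g" unfolding gauge_def g_def using r \<eta> by auto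
  have box: "S \<subseteq> cbox L U" "box L U \<noteq> {}" using S(2) LU by auto
  obtain \<D> where D: "countable \<D>" "\<Union>\<D> \<subseteq> cbox L U"
      "\<And>K. K \<in> \<D> \<Longrightarrow> interior K \<noteq> {} \<and> (\<exists>c d. K = cbox c d)"
      "pairwise (\<lambda>A B. interior A \<inter> interior B = {}) \<D>"
      "\<And>K. K \<in> \<D> \<Longrightarrow> \<exists>x \<in> S \<inter> K. K \<subseteq> g x"
      "\<And>u v. cbox u v \<in> \<D> \<Longrightarrow> \<exists>n. \<forall>i \<in> Basis. v \<bullet> i - u \<bullet> i = (U \<bullet> i - L \<bullet> i) / 2^n"
      "S \<subseteq> \<Union>\<D>"
    by (rule covering_lemma[OF box ga]) (rule that)
  have Dm: "K \<in> lmeasurable" if "K \<in> \<D>" for K using D(3)[OF that] by auto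
  have neg: "negligible (A \<inter> B)" if "A \<in> \<D>" "B \<in> \<D>" "A \<noteq> B" for A B
  proof -
    have "convex (A \<inter> B)" using D(3) that by (metis convex_Int convex_box(1))
    moreover have "interior (A \<inter> B) = {}" using D(4) that by (simp add: pairwise_def)
    ultimately show ?thesis by (simp add: negligible_convex_interior)
  qed
  have DT: "K \<subseteq> T" if "K \<in> \<D>" for K
  proof -
    obtain x where x: "x \<in> S" "K \<subseteq> g x" using D(5) \<open>K \<in> \<D>\<close> by blast
    then have "x \<in> T" using T by auto
    then have "g x \<subseteq> T" using r[of x] by (auto simp: g_def)
    then show ?thesis using x by auto
  qed
  have bdd: "measure lebesgue (\<Union>D') \<le> U - L" if "D' \<subseteq> \<D>" "finite D'" for D'
  proof -
    have "measure lebesgue (\<Union>D') \<le> measure lebesgue {L..U}"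
      using that D(2) Dm by (intro measure_mono_fmeasurable) (auto intro!: fmeasurableD fmeasurable.finite_Union)
    then show ?thesis using LU by simp
  qed
  \<comment> \<open>Finitely many cells carry almost all of the measure, and for these the measures
    simply add up.\<close>
  obtain D' where D': "D' \<subseteq> \<D>" "finite D'" "measure lebesgue (\<Union>\<D>) - e < measure lebesgue (\<Union>D')"
    by (rule measure_countable_Union_approachable[OF D(1) e Dm bdd])
  have "measure lebesgue S \<le> measure lebesgue (\<Union>\<D>)"
  proof (rule measure_mono_fmeasurable[OF D(7)])
    show "\<Union>\<D> \<in> lmeasurable"
    proof (rule bounded_set_imp_lmeasurable)
      show "bounded (\<Union>\<D>)" using bounded_cbox D(2) by (rule bounded_subset)
      show "\<Union>\<D> \<in> sets lebesgue"
        using Dm by (intro sets.countable_Union D(1)) (auto intro: fmeasurableD)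
    qed
  qed (use S in auto)
  then have big: "measure lebesgue (\<Union>D') > measure lebesgue S - e" using D' by simp
  have "\<exists>K\<in>\<D>. measure lebesgue (K - S) \<le> \<kappa> * measure lebesgue K"
  proof (rule ccontr)
    assume no: "\<not> ?thesis"
    have *: "measure lebesgue (K - S) \<ge> \<kappa> * measure lebesgue K" if "K \<in> D'" for K
    proof -
      have "K \<in> \<D>" using D'(1) that by blast
      with no have "\<not> measure lebesgue (K - S) \<le> \<kappa> * measure lebesgue K" by blast
      then show ?thesis by simp
    qed
    have KS: "K - S \<in> lmeasurable" if "K \<in> \<D>" for K
      using Dm[OF that] Sm by (rule fmeasurable.Diff)
    have "measure lebesgue (\<Union>D') = (\<Sum>K\<in>D'. measure lebesgue K)"
    proof (rule measure_negligible_finite_Union)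
      show "pairwise (\<lambda>S T. negligible (S \<inter> T)) D'"
        unfolding pairwise_def using neg D'(1) by blast
      show "K \<in> lmeasurable" if "K \<in> D'" for K using Dm D'(1) that by blast
    qed (rule D'(2))
    then have "\<kappa> * measure lebesgue (\<Union>D') = (\<Sum>K\<in>D'. \<kappa> * measure lebesgue K)"
      by (simp only: sum_distrib_left)
    also have "\<dots> \<le> (\<Sum>K\<in>D'. measure lebesgue (K - S))" by (intro sum_mono *)
    also have "\<dots> = measure lebesgue (\<Union>((\<lambda>K. K - S) ` D'))"
    proof (rule measure_negligible_finite_Union_image[symmetric])
      show "pairwise (\<lambda>x y. negligible ((x - S) \<inter> (y - S))) D'"
        unfolding pairwise_def
      proof (intro ballI impI)
        fix A B assume "A \<in> D'" "B \<in> D'" "A \<noteq> B"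
        then have "negligible (A \<inter> B)" using neg D' by auto
        then show "negligible ((A - S) \<inter> (B - S))" by (rule negligible_subset) auto
      qed
    qed (use D' KS in auto)
    also have "\<dots> \<le> measure lebesgue (T - S)"
    proof (rule measure_mono_fmeasurable)
      show "\<Union>((\<lambda>K. K - S) ` D') \<subseteq> T - S" using DT D'(1) by blast
      show "\<Union>((\<lambda>K. K - S) ` D') \<in> sets lebesgue"
        using D' KS by (intro sets.finite_UN) (auto dest: fmeasurableD)
    qed (rule T(3))
    finally have "\<kappa> * measure lebesgue (\<Union>D') < e" using TS by simp
    moreover have "\<kappa> * measure lebesgue (\<Union>D') \<ge> \<kappa> * (measure lebesgue S - e)"
      using big \<kappa> by (intro mult_left_mono) auto
    moreover have "\<kappa> * e \<le> 1 * e" using \<kappa> e by (intro mult_right_mono) auto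
    ultimately show False using e by (simp add: e_def algebra_simps)
  qed
  then obtain K where K: "K \<in> \<D>" "measure lebesgue (K - S) \<le> \<kappa> * measure lebesgue K" by blast
  obtain \<alpha> \<beta> where ab: "K = {\<alpha>..\<beta>}" using D(3)[OF K(1)] by (auto simp: cbox_interval)
  have lt: "\<alpha> < \<beta>" using D(3)[OF K(1)] ab by auto
  obtain x where x: "x \<in> S" "K \<subseteq> g x" using D(5)[OF K(1)] by blast
  then have "x \<in> T" using T by auto
  then have sub: "{\<alpha>..\<beta>} \<subseteq> ball x (\<eta> / 2)" using x ab by (auto simp: g_def)
  then have "dist x \<alpha> < \<eta> / 2" "dist x \<beta> < \<eta> / 2" using lt by (auto simp: subset_iff)
  then have "\<beta> - \<alpha> \<le> \<eta>" unfolding dist_real_def by linarith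
  moreover have "K \<subseteq> cbox L U" using D(2) K(1) by blast
  then have "{\<alpha>..\<beta>} \<subseteq> {L..U}" by (simp only: ab cbox_interval)
  ultimately show ?thesis using that[of \<alpha> \<beta>] lt K ab by simp
qed

text \<open>The majorant is bounded below only within distance \<open>1 / 6\<close> of a prime, so three of its
  translates are needed to cover \<open>[q + a, q + a + 1)\<close>.\<close>
lemma card_hits_le:
  fixes c :: real
  assumes R: "R \<ge> 1" and L: "L > 0" "L \<le> c" and a: "a \<ge> 1"
  shows "real (card {p \<in> primes_le n. c \<in> hits a p})
         \<le> (real R + a + 1) powr (1 / L) + 12 * real (card (primes_le n)) / ln (real R + 1)
           + 6 * sieve_error R (primes_le n) c"
proof -
  let ?P = "primes_le n"
  \<comment> \<open>The majorant detects only primes \<open>q > R\<close>. This is ensured by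
    \<open>p powr c \<ge> R + a + 1\<close>; the few smaller \<open>p\<close> are counted
    trivially.\<close>
  let ?A = "{p \<in> ?P. real p powr c < real R + a + 1}"
  let ?B = "{p \<in> ?P. c \<in> hits a p \<and> real p powr c \<ge> real R + a + 1}"
  let ?F = "\<lambda>i p. selberg_majorant R (real p powr c - (a + i / 6))"
  let ?x = "real (card ?P) * (2 / ln (real R + 1)) + sieve_error R ?P c"
  have c0: "c > 0" using L by simp
  have "card {p \<in> ?P. c \<in> hits a p} \<le> card (?A \<union> ?B)" by (intro card_mono) auto
  also have "\<dots> \<le> card ?A + card ?B" by (rule card_Un_le)
  finally have 1: "real (card {p \<in> ?P. c \<in> hits a p}) \<le> real (card ?A) + real (card ?B)" by simp
  have 2: "real (card ?A) \<le> (real R + a + 1) powr (1 / L)"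
  proof -
    let ?y = "(real R + a + 1) powr (1 / L)"
    have "?A \<subseteq> {1..nat \<lfloor>?y\<rfloor>}"
    proof
      fix p assume p: "p \<in> ?A"
      then have p1: "p \<ge> 1" using primes_le_subset[of n] by auto
      have "real p = (real p powr c) powr (1 / c)" using c0 p1 by (simp add: powr_powr)
      also have "\<dots> \<le> (real R + a + 1) powr (1 / c)" using p c0 by (intro powr_mono2) auto
      also have "\<dots> \<le> ?y" using L a by (intro powr_mono divide_left_mono) auto
      finally show "p \<in> {1..nat \<lfloor>?y\<rfloor>}" using p1 by (auto simp: le_nat_floor)
    qed
    then have "card ?A \<le> card {1..nat \<lfloor>?y\<rfloor>}" by (intro card_mono) auto
    then have "real (card ?A) \<le> real (nat \<lfloor>?y\<rfloor>)" by (simp only: of_nat_le_iff card_atLeastAtMost)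
    also have "\<dots> \<le> ?y" by (rule of_nat_floor) simp
    finally show ?thesis .
  qed
  have "real (card ?B) = (\<Sum>p\<in>?B. 1)" by simp
  also have "\<dots> \<le> (\<Sum>p\<in>?B. 2 * (?F 1 p + ?F 3 p + ?F 5 p))"
  proof (intro sum_mono)
    fix p assume "p \<in> ?B"
    then obtain q where q: "prime q" "\<lfloor>real p powr c\<rfloor> = int q + a" and big: "real p powr c \<ge> real R + a + 1"
      by (auto simp: hits_def)
    have y: "real q + a \<le> real p powr c" "real p powr c < real q + a + 1"
      using q(2) by (auto simp: floor_eq_iff)
    have "q > R" using big y by linarith
    then have F: "?F i p \<ge> 1 / 2" if "\<bar>real p powr c - (a + i / 6) - real q\<bar> \<le> 1 / 6" for i
      using selberg_majorant_ge_half[OF R q(1)] that by blast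
    have "\<bar>real p powr c - (a + 1 / 6) - real q\<bar> \<le> 1 / 6 \<or> \<bar>real p powr c - (a + 3 / 6) - real q\<bar> \<le> 1 / 6
        \<or> \<bar>real p powr c - (a + 5 / 6) - real q\<bar> \<le> 1 / 6" unfolding abs_le_iff using y by arith
    then have "?F 1 p \<ge> 1 / 2 \<or> ?F 3 p \<ge> 1 / 2 \<or> ?F 5 p \<ge> 1 / 2" using F by blast
    then show "1 \<le> 2 * (?F 1 p + ?F 3 p + ?F 5 p)"
      using selberg_majorant_nonneg[of R "real p powr c - (a + 1 / 6)"]
        selberg_majorant_nonneg[of R "real p powr c - (a + 3 / 6)"]
        selberg_majorant_nonneg[of R "real p powr c - (a + 5 / 6)"] by (elim disjE; simp)
  qed
  also have "\<dots> \<le> (\<Sum>p\<in>?P. 2 * (?F 1 p + ?F 3 p + ?F 5 p))"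
    by (intro sum_mono2) (auto intro!: add_nonneg_nonneg selberg_majorant_nonneg)
  also have "\<dots> = 2 * ((\<Sum>p\<in>?P. ?F 1 p) + (\<Sum>p\<in>?P. ?F 3 p) + (\<Sum>p\<in>?P. ?F 5 p))"
    by (simp only: sum.distrib sum_distrib_left[symmetric])
  also have "\<dots> \<le> 2 * (?x + ?x + ?x)"
    by (intro mult_left_mono add_mono sum_selberg_majorant_le R) auto
  also have "\<dots> = 12 * real (card ?P) / ln (real R + 1) + 6 * sieve_error R ?P c" by simp
  finally show ?thesis using 1 2 by linarith
qed

text \<open>\<open>R\<close> is a fixed power of \<open>n\<close>, so \<open>ln R\<close> is of
  order \<open>ln n\<close> and the second logarithm is saved; the power is small enough for the
  sieve error to be negligible on average.\<close>

lemma card_hits_mean_upper: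
  assumes L: "0 < L" "L \<le> U" and a: "a \<ge> 1"
  obtains K err where "K > 0" "\<And>n. continuous_on {L..U} (err n)" "\<And>n c. err n c \<ge> (0::real)"
    "(\<lambda>n. integral {L..U} (err n) * ((ln n)\<^sup>2 / n)) \<longlonglongrightarrow> 0"
    "eventually (\<lambda>n. \<forall>c\<in>{L..U}. real (card {p \<in> primes_le n. c \<in> hits a p}) \<le> K * (n / (ln n)\<^sup>2) + err n c) sequentially"
proof -
  define \<alpha> where "\<alpha> = min 1 L"
  have al: "0 < \<alpha>" "\<alpha> \<le> 1" "\<alpha> \<le> L" using L by (auto simp: \<alpha>_def)
  \<comment> \<open>With this \<open>R\<close> and the parameter
    \<open>n powr (1 - \<alpha> / 4)\<close> in the mean value bound, the error is, up to constants
    and logarithms, at most the sum of the powers \<open>n powr (1 - 3 * \<alpha> / 20)\<close> and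
    \<open>n powr (1 - 3 * \<alpha> / 5)\<close>.\<close>
  define R where "R = (\<lambda>n::nat. nat \<lfloor>real n powr (\<alpha> / 40)\<rfloor>)"
  define err where "err = (\<lambda>n c. 6 * sieve_error (R n) (primes_le n) c)"
  define C where "C = (2 + 2 * ln 4 :: real)"
  define K where "K = 1 + 12 * C * 40 / \<alpha>"
  have C: "C > 0" by (simp add: C_def add_pos_pos)
  have R_le: "real (R n) \<le> real n powr (\<alpha> / 40)" for n
    unfolding R_def by (rule of_nat_floor) simp
  have R_ge: "real (R n) + 1 \<ge> real n powr (\<alpha> / 40)" for n
    unfolding R_def by linarith
  have R1: "R n \<ge> 1" if "n \<ge> 1" for n
    unfolding R_def using that al by (auto simp: le_nat_floor ge_one_powr_ge_zero)
  show ?thesis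
  proof (rule that[of K err])
    show "K > 0" using C al by (simp add: K_def add_pos_nonneg)
    show cont: "continuous_on {L..U} (err n)" for n
      unfolding err_def by (intro continuous_intros continuous_on_sieve_error[OF primes_le_subset])
    show nonneg: "err n c \<ge> 0" for n c
      unfolding err_def using sieve_error_nonneg by simp
    define W where "W = U - L"
    define g where "g = (\<lambda>n::nat. 3 * real n powr (\<alpha> / 10) * (real n powr (1 - \<alpha> / 4) * W +
       (W * real n powr (2 - \<alpha>) + 2 * real n powr (2 - \<alpha>) * (1 + ln n) * real n powr (\<alpha> / 20)) / real n powr (1 - \<alpha> / 4)))"
    have W: "W \<ge> 0" using L by (simp add: W_def)
    show "(\<lambda>n. integral {L..U} (err n) * ((ln n)\<^sup>2 / n)) \<longlonglongrightarrow> 0"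
    proof (rule tendsto_sandwich[OF _ _ tendsto_const])
      show "(\<lambda>n. g n * ((ln n)\<^sup>2 / n)) \<longlonglongrightarrow> 0"
        unfolding g_def using al W by real_asymp
      show "\<forall>\<^sub>F n in sequentially. 0 \<le> integral {L..U} (err n) * ((ln n)\<^sup>2 / n)"
        using cont nonneg by (intro always_eventually allI mult_nonneg_nonneg integral_nonneg integrable_continuous_interval) auto
      show "\<forall>\<^sub>F n in sequentially. integral {L..U} (err n) * ((ln n)\<^sup>2 / n) \<le> g n * ((ln n)\<^sup>2 / n)"
        using eventually_ge_at_top[of 1]
      proof eventually_elim
        case (elim n)
        let ?t = "real n powr (1 - \<alpha> / 4)"
        have lnn: "0 \<le> ln (real n)" using elim by simp
        have R4: "real (R n) ^ 4 \<le> real n powr (\<alpha> / 10)"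
        proof -
          have "real (R n) ^ 4 \<le> (real n powr (\<alpha> / 40)) ^ 4" by (intro power_mono R_le) auto
          also have "\<dots> = real n powr (\<alpha> / 10)" using elim by (simp add: powr_power)
          finally show ?thesis .
        qed
        have R2: "real (R n) ^ 2 \<le> real n powr (\<alpha> / 20)"
        proof -
          have "real (R n) ^ 2 \<le> (real n powr (\<alpha> / 40)) ^ 2" by (intro power_mono R_le) auto
          also have "\<dots> = real n powr (\<alpha> / 20)" using elim by (simp add: powr_power)
          finally show ?thesis .
        qed
        have n2: "real n \<le> real n powr (2 - \<alpha>)"
          using powr_mono[of 1 "2 - \<alpha>" "real n"] elim al by simp
        have "integral {L..U} (err n) = 6 * integral {L..U} (sieve_error (R n) (primes_le n))"
          unfolding err_def by simp
        also have "\<dots> \<le> 6 * (real (R n) ^ 4 * (?t * W + (W * n + 2 * real n powr (2 - \<alpha>) * (1 + ln n) * real (R n) ^ 2) / ?t) / 2)"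
          using integral_sieve_error_le[OF primes_le_subset, of n \<alpha> L U ?t "R n"] elim al L
          by (intro mult_left_mono) (auto simp: W_def)
        also have "\<dots> = 3 * real (R n) ^ 4 * (?t * W + (W * n + 2 * real n powr (2 - \<alpha>) * (1 + ln n) * real (R n) ^ 2) / ?t)"
          by simp
        also have "\<dots> \<le> g n"
          unfolding g_def using lnn W
          by (intro mult_mono add_mono divide_right_mono R4 R2 n2 order_refl mult_nonneg_nonneg add_nonneg_nonneg divide_nonneg_nonneg) auto
        finally show ?case by (intro mult_right_mono) auto
      qed
    qed
    have ev1: "eventually (\<lambda>n. real n powr (\<alpha> / 40) + a + 1 \<le> real n powr (L / 2)) sequentially"
    proof -
      have "\<alpha> / 40 < L / 2" "0 < \<alpha> / 40" using al by auto
      then show ?thesis by real_asymp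
    qed
    have ev2: "eventually (\<lambda>n. real n powr (1 / 2) \<le> real n / (ln n)\<^sup>2) sequentially" by real_asymp
    show "eventually (\<lambda>n. \<forall>c\<in>{L..U}. real (card {p \<in> primes_le n. c \<in> hits a p}) \<le> K * (n / (ln n)\<^sup>2) + err n c) sequentially"
      using ev1 ev2 eventually_ge_at_top[of 2]
    proof eventually_elim
      case (elim n)
      have lnn: "ln (real n) > 0" using elim by simp
      have 1: "(real (R n) + a + 1) powr (1 / L) \<le> real n / (ln n)\<^sup>2"
      proof -
        have "(real (R n) + a + 1) powr (1 / L) \<le> (real n powr (L / 2)) powr (1 / L)"
          using elim R_le[of n] a L by (intro powr_mono2) auto
        also have "\<dots> = real n powr (1 / 2)" using L by (simp add: powr_powr)
        finally show ?thesis using elim by linarith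
      qed
      have "\<alpha> / 40 * ln n = ln (real n powr (\<alpha> / 40))" using elim by simp
      also have "\<dots> \<le> ln (real (R n) + 1)" using R_ge[of n] elim by (subst ln_le_cancel_iff) auto
      finally have lnR: "\<alpha> / 40 * ln n \<le> ln (real (R n) + 1)" .
      have "12 * real (card (primes_le n)) / ln (real (R n) + 1) \<le> 12 * (C * real n / ln n) / (\<alpha> / 40 * ln n)"
        using card_primes_le_upper[of n] lnR al lnn elim C
        by (intro frac_le) (auto simp: C_def)
      also have "\<dots> = 12 * C * 40 / \<alpha> * (real n / (ln n)\<^sup>2)" by (simp add: power2_eq_square mult_ac)
      finally have 2: "12 * real (card (primes_le n)) / ln (real (R n) + 1) \<le> 12 * C * 40 / \<alpha> * (real n / (ln n)\<^sup>2)" .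
      show ?case
      proof
        fix c assume "c \<in> {L..U}"
        then have "L \<le> c" by simp
        moreover have "K * (n / (ln n)\<^sup>2) = real n / (ln n)\<^sup>2 + 12 * C * 40 / \<alpha> * (real n / (ln n)\<^sup>2)"
          by (simp only: K_def distrib_right mult_1_left)
        moreover have "R n \<ge> 1" using elim by (intro R1) auto
        ultimately show "real (card {p \<in> primes_le n. c \<in> hits a p}) \<le> K * (n / (ln n)\<^sup>2) + err n c"
          using card_hits_le[OF _ L(1) _ a, of "R n" c n] 1 2 unfolding err_def by linarith
      qed
    qed
  qed
qed

section \<open>Almost all exponents\<close>

lemma lmeasurable_hits_Int: "S \<in> sets lebesgue \<Longrightarrow> S \<subseteq> {L..U} \<Longrightarrow> hits a p \<inter> S \<in> lmeasurable"
  by (rule bounded_set_imp_lmeasurable) (auto intro: bounded_subset[of "{L..U}"])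

text \<open>The sum of the measures is the integral of the count over \<open>S\<close>. As
  \<open>g\<close> is nonnegative, its integral may be extended to \<open>[L, U]\<close>, so the
  error is independent of \<open>S\<close>.\<close>

lemma sum_measure_hits_le_integral:
  assumes S: "S \<in> sets lebesgue" "S \<subseteq> {L..U}"
    and g: "continuous_on {L..U} g" "\<And>c. g c \<ge> 0"
    and bound: "\<And>c. c \<in> S \<Longrightarrow> real (card {p \<in> primes_le n. c \<in> hits a p}) \<le> B + g c"
  shows "(\<Sum>p\<in>primes_le n. measure lebesgue (hits a p \<inter> S)) \<le> B * measure lebesgue S + integral {L..U} g"
proof -
  have Sm: "S \<in> lmeasurable"
    using S bounded_subset[of "{L..U}" S] by (intro bounded_set_imp_lmeasurable) auto
  have hm: "hits a p \<inter> S \<in> lmeasurable" for p using S by (rule lmeasurable_hits_Int)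
  have hi: "integrable lebesgue (indicator (hits a p \<inter> S) :: real \<Rightarrow> real)" for p
    using hm by (simp only: lmeasurable_iff_integrable)
  have gi: "set_integrable lebesgue {L..U} g"
    using absolutely_integrable_continuous_real[OF g(1)] .
  have "(\<Sum>p\<in>primes_le n. measure lebesgue (hits a p \<inter> S))
      = (\<integral>c. (\<Sum>p\<in>primes_le n. indicator (hits a p \<inter> S) c) \<partial>lebesgue)"
    using hi by (subst Bochner_Integration.integral_sum) auto
  also have "\<dots> \<le> (\<integral>c. B * indicator S c + indicator {L..U} c *\<^sub>R g c \<partial>lebesgue)"
  proof (rule integral_mono)
    show "integrable lebesgue (\<lambda>c. \<Sum>p\<in>primes_le n. indicator (hits a p \<inter> S) c :: real)"
      using hi by (intro Bochner_Integration.integrable_sum)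
    show "integrable lebesgue (\<lambda>c. B * indicator S c + indicator {L..U} c *\<^sub>R g c)"
      using gi Sm unfolding set_integrable_def lmeasurable_iff_integrable
      by (intro Bochner_Integration.integrable_add integrable_mult_right)
    fix c
    have "(\<Sum>p\<in>primes_le n. indicator (hits a p \<inter> S) c) = (if c \<in> S then real (card {p \<in> primes_le n. c \<in> hits a p}) else 0)"
    proof (cases "c \<in> S")
      case True
      then have "(\<Sum>p\<in>primes_le n. indicator (hits a p \<inter> S) c) = (\<Sum>p\<in>primes_le n. if c \<in> hits a p then 1 else 0 :: real)"
        by (intro sum.cong) (auto simp: indicator_def)
      then show ?thesis using True by (simp add: sum.If_cases Int_def)
    qed simp
    also have "\<dots> \<le> B * indicator S c + indicator {L..U} c *\<^sub>R g c"
      using bound[of c] g(2)[of c] S(2) by (auto simp: indicator_def)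
    finally show "(\<Sum>p\<in>primes_le n. indicator (hits a p \<inter> S) c) \<le> B * indicator S c + indicator {L..U} c *\<^sub>R g c" .
  qed
  also have "\<dots> = B * measure lebesgue S + integral {L..U} g"
  proof -
    have "(\<integral>c. indicator {L..U} c *\<^sub>R g c \<partial>lebesgue) = integral {L..U} g"
      using set_lebesgue_integral_eq_integral(2)[OF gi] by (simp add: set_lebesgue_integral_def)
    then show ?thesis
      using gi Sm unfolding set_integrable_def lmeasurable_iff_integrable
      by (subst Bochner_Integration.integral_add) (auto intro: integrable_mult_right)
  qed
  finally show ?thesis .
qed

text \<open>Both sides estimate the integral of the count over \<open>[\<alpha>, \<beta>]\<close> in
  units of \<open>n / (ln n)\<^sup>2\<close>. From above, the assumption is used on
  \<open>E\<close>, where \<open>c \<ge> \<alpha>\<close>, and the sieve off \<open>E\<close>; from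
  below, the measure of the hits is summed over many primes.\<close>

lemma interval_density_inequality:
  assumes L: "0 < L" "L \<le> \<alpha>" "\<alpha> < \<beta>" "\<beta> \<le> U" and a: "a \<ge> 1"
    and E: "E \<in> sets lebesgue" and \<delta>: "0 < \<delta>" "\<delta> < 1"
    and bad: "\<And>c n. c \<in> E \<Longrightarrow> n \<ge> N \<Longrightarrow> c * real (card {p \<in> primes_le n. c \<in> hits a p}) \<le> (1 - \<delta>) * (n / (ln n)\<^sup>2)"
    and err: "\<And>n. continuous_on {L..U} (err n)" "\<And>n c. err n c \<ge> (0::real)"
      "(\<lambda>n. integral {L..U} (err n) * ((ln n)\<^sup>2 / n)) \<longlonglongrightarrow> 0"
    and upper: "eventually (\<lambda>n. \<forall>c\<in>{L..U}. real (card {p \<in> primes_le n. c \<in> hits a p}) \<le> K * (n / (ln n)\<^sup>2) + err n c) sequentially"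
  shows "(\<beta> - \<alpha>) / \<beta> \<le> (1 - \<delta>) / \<alpha> * (\<beta> - \<alpha>) + K * measure lebesgue ({\<alpha>..\<beta>} - E)"
proof -
  define I where "I = {\<alpha>..\<beta>}"
  define w where "w = (\<beta> - \<alpha>) / \<beta>"
  define X where "X = (1 - \<delta>) / \<alpha> * (\<beta> - \<alpha>) + K * measure lebesgue (I - E)"
  have al: "\<alpha> > 0" "\<beta> > 0" using L by auto
  have w: "w > 0" using L al by (simp add: w_def)
  have Im: "I \<in> sets lebesgue" by (simp add: I_def)
  have IL: "I \<subseteq> {L..U}" using L by (auto simp: I_def)
  \<comment> \<open>One \<open>\<epsilon>\<close> is lost in the measure of the hits, one in the
    number of primes, one by discarding small primes, and the last by the mean of
    \<open>err\<close>.\<close>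
  have main: "(w - \<epsilon>) * (1 - 2 * \<epsilon>) - \<epsilon> \<le> X" if \<epsilon>: "0 < \<epsilon>" "\<epsilon> < 1 / 2" "\<epsilon> < w" for \<epsilon>
  proof -
    obtain P where P: "\<And>p. p \<ge> P \<Longrightarrow> measure lebesgue (hits a p \<inter> I) * ln p \<ge> w - \<epsilon>"
      using eventually_measure_hits_ge[of \<alpha> \<beta> a \<epsilon>] L a \<epsilon> unfolding eventually_at_top_linorder w_def I_def by auto
    have "eventually (\<lambda>n. integral {L..U} (err n) * ((ln n)\<^sup>2 / n) < \<epsilon>) sequentially"
      using err(3) \<epsilon> by (intro order_tendstoD(2)) auto
    moreover have "eventually (\<lambda>n. real P * ln n / n < \<epsilon>) sequentially"
    proof (rule order_tendstoD(2))
      show "(\<lambda>n. real P * ln (real n) / real n) \<longlonglongrightarrow> 0" by real_asymp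
    qed (use \<epsilon> in auto)
    ultimately have "eventually (\<lambda>n. integral {L..U} (err n) * ((ln n)\<^sup>2 / n) < \<epsilon> \<and> real P * ln n / n < \<epsilon> \<and> n \<ge> N \<and> n \<ge> 2 \<and>
        (\<forall>c\<in>{L..U}. real (card {p \<in> primes_le n. c \<in> hits a p}) \<le> K * (n / (ln n)\<^sup>2) + err n c)) sequentially"
      using upper eventually_ge_at_top[of N] eventually_ge_at_top[of 2] by eventually_elim blast
    then obtain M where M: "\<And>n. n \<ge> M \<Longrightarrow> integral {L..U} (err n) * ((ln n)\<^sup>2 / n) < \<epsilon> \<and> real P * ln n / n < \<epsilon> \<and> n \<ge> N \<and> n \<ge> 2 \<and>
        (\<forall>c\<in>{L..U}. real (card {p \<in> primes_le n. c \<in> hits a p}) \<le> K * (n / (ln n)\<^sup>2) + err n c)"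
      unfolding eventually_sequentially by blast
    obtain n where n: "n \<ge> M" "real (card (primes_le n)) \<ge> (1 - \<epsilon>) * n / ln n"
      using frequently_card_primes_le_ge[of \<epsilon> M] \<epsilon> by auto
    note Mn = M[OF n(1)]
    have n2: "n \<ge> 2" "n \<ge> N" using Mn by auto
    have lnn: "ln (real n) > 0" using n2 by simp
    define y where "y = real n / (ln n)\<^sup>2"
    have y: "y > 0" using n2 lnn by (simp add: y_def)
    have y': "(ln n)\<^sup>2 / n = 1 / y" by (simp add: y_def)
    define T where "T = (\<lambda>S. \<Sum>p\<in>primes_le n. measure lebesgue (hits a p \<inter> S))"
    have "T I = T (I \<inter> E) + T (I - E)"
    proof -
      have "measure lebesgue (hits a p \<inter> I) = measure lebesgue (hits a p \<inter> (I \<inter> E)) + measure lebesgue (hits a p \<inter> (I - E))" for p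
      proof -
        have m: "hits a p \<inter> (I \<inter> E) \<in> lmeasurable" "hits a p \<inter> (I - E) \<in> lmeasurable"
          using IL E Im by (auto intro!: lmeasurable_hits_Int[of _ L U])
        have "hits a p \<inter> I = (hits a p \<inter> (I \<inter> E)) \<union> (hits a p \<inter> (I - E))" by auto
        also have "measure lebesgue \<dots> = measure lebesgue (hits a p \<inter> (I \<inter> E)) + measure lebesgue (hits a p \<inter> (I - E))"
        proof (rule measure_Union)
          show "emeasure lebesgue (hits a p \<inter> (I \<inter> E)) \<noteq> \<infinity>" "emeasure lebesgue (hits a p \<inter> (I - E)) \<noteq> \<infinity>"
            using fmeasurableD2[OF m(1)] fmeasurableD2[OF m(2)] by auto
        qed (use m in \<open>auto dest: fmeasurableD\<close>)
        finally show ?thesis .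
      qed
      then show ?thesis by (simp add: T_def sum.distrib)
    qed
    moreover have "T (I \<inter> E) \<le> (1 - \<delta>) / \<alpha> * y * measure lebesgue (I \<inter> E) + integral {L..U} (\<lambda>_. 0)"
      unfolding T_def
    proof (rule sum_measure_hits_le_integral)
      fix c assume c: "c \<in> I \<inter> E"
      have "\<alpha> * real (card {p \<in> primes_le n. c \<in> hits a p}) \<le> c * real (card {p \<in> primes_le n. c \<in> hits a p})"
        using c by (intro mult_right_mono) (auto simp: I_def)
      also have "\<dots> \<le> (1 - \<delta>) * y" using bad[of c n] c n2 by (simp add: y_def)
      finally show "real (card {p \<in> primes_le n. c \<in> hits a p}) \<le> (1 - \<delta>) / \<alpha> * y + 0"
        using al by (simp add: field_simps)
    qed (use IL E Im in auto)
    moreover have "T (I - E) \<le> K * y * measure lebesgue (I - E) + integral {L..U} (err n)"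
      unfolding T_def
    proof (rule sum_measure_hits_le_integral)
      fix c assume "c \<in> I - E"
      then show "real (card {p \<in> primes_le n. c \<in> hits a p}) \<le> K * y + err n c"
        using Mn IL by (auto simp: y_def)
    qed (use IL E Im err in auto)
    moreover have "integral {L..U} (err n) \<le> \<epsilon> * y" using Mn y by (simp add: y' field_simps)
    moreover have "(1 - \<delta>) / \<alpha> * y * measure lebesgue (I \<inter> E) \<le> (1 - \<delta>) / \<alpha> * y * (\<beta> - \<alpha>)"
    proof (rule mult_left_mono)
      show "measure lebesgue (I \<inter> E) \<le> \<beta> - \<alpha>"
        using measure_mono_fmeasurable[OF Int_lower1 sets.Int[OF Im E]] L by (simp add: I_def)
    qed (use \<delta> al y in auto)
    moreover have "(X + \<epsilon>) * y = (1 - \<delta>) / \<alpha> * y * (\<beta> - \<alpha>) + K * y * measure lebesgue (I - E) + \<epsilon> * y"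
      by (simp add: X_def algebra_simps)
    ultimately have up: "T I \<le> (X + \<epsilon>) * y" by simp
    have "(w - \<epsilon>) * (1 - 2 * \<epsilon>) * y \<le> T I"
    proof -
      \<comment> \<open>The measure estimate holds only from \<open>P\<close> on; the omitted primes
        are at most \<open>P\<close> in number, which is below
        \<open>\<epsilon> * n / ln n\<close>.\<close>
      let ?A = "primes_le n - {..<P}"
      have "card (primes_le n) \<le> card ?A + card {..<P}"
        by (rule order_trans[OF _ card_Un_le]) (auto intro!: card_mono)
      then have cA: "real (card ?A) \<ge> real (card (primes_le n)) - P" by simp
      have "(1 - 2 * \<epsilon>) * n / ln n \<le> real (card ?A)"
      proof -
        have "real P \<le> \<epsilon> * n / ln n" using Mn lnn n2 by (simp add: field_simps)
        moreover have "(1 - 2 * \<epsilon>) * n / ln n = (1 - \<epsilon>) * n / ln n - \<epsilon> * n / ln n"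
          by (simp add: diff_divide_distrib[symmetric] algebra_simps)
        ultimately show ?thesis using cA n(2) by linarith
      qed
      then have "(w - \<epsilon>) / ln n * ((1 - 2 * \<epsilon>) * n / ln n) \<le> (w - \<epsilon>) / ln n * real (card ?A)"
        using \<epsilon> lnn by (intro mult_left_mono) auto
      moreover have "(w - \<epsilon>) / ln n * ((1 - 2 * \<epsilon>) * n / ln n) = (w - \<epsilon>) * (1 - 2 * \<epsilon>) * y"
        by (simp add: y_def power2_eq_square)
      moreover have "(w - \<epsilon>) / ln n * real (card ?A) = (\<Sum>p\<in>?A. (w - \<epsilon>) / ln n)" by simp
      moreover have "\<dots> \<le> (\<Sum>p\<in>?A. measure lebesgue (hits a p \<inter> I))"
      proof (intro sum_mono)
        fix p assume "p \<in> ?A"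
        then have p: "p \<ge> P" "p \<ge> 2" "p \<le> n" by (auto simp: primes_le_def prime_ge_2_nat)
        then have lp: "ln (real p) > 0" "ln (real p) \<le> ln n" by auto
        have "(w - \<epsilon>) / ln n \<le> (w - \<epsilon>) / ln p" using \<epsilon> lp by (intro divide_left_mono) auto
        also have "\<dots> \<le> measure lebesgue (hits a p \<inter> I)" using P[OF p(1)] lp by (simp add: field_simps)
        finally show "(w - \<epsilon>) / ln n \<le> measure lebesgue (hits a p \<inter> I)" .
      qed
      moreover have "(\<Sum>p\<in>?A. measure lebesgue (hits a p \<inter> I)) \<le> T I"
        unfolding T_def by (intro sum_mono2) auto
      ultimately show ?thesis by linarith
    qed
    with up have "(w - \<epsilon>) * (1 - 2 * \<epsilon>) * y \<le> (X + \<epsilon>) * y" by linarith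
    then show ?thesis using y by simp
  qed
  have "w \<le> X"
  proof (rule tendsto_upperbound)
    show "((\<lambda>\<epsilon>. (w - \<epsilon>) * (1 - 2 * \<epsilon>) - \<epsilon>) \<longlongrightarrow> w) (at_right 0)"
      by (auto intro!: tendsto_eq_intros)
    have "eventually (\<lambda>\<epsilon>. \<epsilon> \<in> {0<..<min (1 / 2) w}) (at_right 0)"
      using w by (intro eventually_at_right_real) auto
    then show "\<forall>\<^sub>F \<epsilon> in at_right 0. (w - \<epsilon>) * (1 - 2 * \<epsilon>) - \<epsilon> \<le> X"
      by eventually_elim (auto intro!: main)
  qed simp
  then show ?thesis by (simp add: w_def X_def I_def)
qed

section \<open>Exceptional sets and their countable union\<close>

text \<open>Fixing the deficit \<open>\<delta>\<close>, the threshold \<open>N\<close> and a bounded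
  range of \<open>c\<close> cuts the bad exponents into measurable pieces, of which countably many
  suffice. Testing integers \<open>n\<close> alone makes each piece a countable
  intersection.\<close>

definition exceptional_set :: "int \<Rightarrow> real \<Rightarrow> nat \<Rightarrow> real \<Rightarrow> real \<Rightarrow> real set" where
  "exceptional_set a \<delta> N L U =
     {c \<in> {L..U}. \<forall>n\<ge>N. c * real (card {p \<in> primes_le n. c \<in> hits a p}) \<le> (1 - \<delta>) * (n / (ln n)\<^sup>2)}"

lemma sets_exceptional_set: "exceptional_set a \<delta> N L U \<in> sets lebesgue"
proof -
  have count: "real (card {p \<in> primes_le n. c \<in> hits a p}) = (\<Sum>p\<in>primes_le n. indicator (hits a p) c)" for c n
    by (simp add: indicator_def sum.If_cases Int_def)
  have "exceptional_set a \<delta> N L U =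
      {L..U} \<inter> (\<Inter>n\<in>{N..}. {c \<in> space lebesgue. c * (\<Sum>p\<in>primes_le n. indicator (hits a p) c) \<le> (1 - \<delta>) * (n / (ln n)\<^sup>2)})"
    unfolding exceptional_set_def count by auto
  also have "\<dots> \<in> sets lebesgue"
  proof (intro sets.Int sets.countable_INT'')
    fix n
    have "(\<lambda>c::real. c) \<in> borel_measurable lebesgue" by (rule measurable_completion) simp
    then show "{c \<in> space lebesgue. c * (\<Sum>p\<in>primes_le n. indicator (hits a p) c) \<le> (1 - \<delta>) * (n / (ln n)\<^sup>2)} \<in> sets lebesgue"
      by (intro borel_measurable_le borel_measurable_times borel_measurable_sum borel_measurable_indicator sets_hits
          borel_measurable_const)
  qed auto
  finally show ?thesis .
qed

text \<open>On a short interval nearly filled by the set, the density inequality gives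
  \<open>\<alpha> / \<beta> \<le> 1 - \<delta> + \<alpha> * K * \<kappa>\<close>, while shortness
  forces \<open>\<alpha> / \<beta>\<close> close to \<open>1\<close>.\<close>

lemma null_exceptional_set:
  assumes L: "0 < L" "L \<le> U" and a: "a \<ge> 1" and \<delta>: "0 < \<delta>" "\<delta> < 1"
  shows "exceptional_set a \<delta> N L U \<in> null_sets lebesgue"
proof (rule ccontr)
  let ?E = "exceptional_set a \<delta> N L U"
  assume not_null: "?E \<notin> null_sets lebesgue"
  have EU: "?E \<subseteq> {L..U}" by (auto simp: exceptional_set_def)
  have Em: "?E \<in> lmeasurable"
    using sets_exceptional_set bounded_subset[OF _ EU] by (intro bounded_set_imp_lmeasurable) auto
  have pos: "measure lebesgue ?E > 0"
    using not_null Em by (simp add: null_sets_def emeasure_eq_measure2 fmeasurableD zero_less_measure_iff)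
  obtain K err where K: "K > 0" and err: "\<And>n. continuous_on {L..U} (err n)" "\<And>n c. err n c \<ge> (0::real)"
      "(\<lambda>n. integral {L..U} (err n) * ((ln n)\<^sup>2 / n)) \<longlonglongrightarrow> 0"
    and upper: "eventually (\<lambda>n. \<forall>c\<in>{L..U}. real (card {p \<in> primes_le n. c \<in> hits a p}) \<le> K * (n / (ln n)\<^sup>2) + err n c) sequentially"
    by (rule card_hits_mean_upper[OF L a]) (rule that)
  \<comment> \<open>Chosen so that \<open>\<alpha> * K * \<kappa> \<le> \<delta> / 4\<close>. The
    length bound \<open>\<delta> * L / 4\<close> likewise gives
    \<open>\<alpha> / \<beta> \<ge> 1 - \<delta> / 4\<close>, and together the losses stay below
    \<open>\<delta>\<close>.\<close>
  define \<kappa> where "\<kappa> = min 1 (\<delta> / (4 * K * U))"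
  have U: "U > 0" using L by simp
  have \<kappa>: "0 < \<kappa>" "\<kappa> \<le> 1" "\<kappa> \<le> \<delta> / (4 * K * U)" using \<delta> K U by (auto simp: \<kappa>_def)
  have \<eta>: "\<delta> * L / 4 > 0" using \<delta> L by simp
  obtain \<alpha> \<beta> where ab: "\<alpha> < \<beta>" "\<beta> - \<alpha> \<le> \<delta> * L / 4" "{\<alpha>..\<beta>} \<subseteq> {L..U}"
      "measure lebesgue ({\<alpha>..\<beta>} - ?E) \<le> \<kappa> * (\<beta> - \<alpha>)"
    using measurable_set_mostly_fills_interval[OF sets_exceptional_set EU pos \<kappa>(1,2) \<eta>] .
  have LU: "L \<le> \<alpha>" "\<beta> \<le> U" using ab(1,3) by auto
  have al: "\<alpha> > 0" "\<beta> > 0" using LU L ab by auto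
  have "(\<beta> - \<alpha>) / \<beta> \<le> (1 - \<delta>) / \<alpha> * (\<beta> - \<alpha>) + K * measure lebesgue ({\<alpha>..\<beta>} - ?E)"
    by (rule interval_density_inequality[OF L(1) LU(1) ab(1) LU(2) a sets_exceptional_set \<delta> _ err upper])
       (auto simp: exceptional_set_def)
  also have "\<dots> \<le> (1 - \<delta>) / \<alpha> * (\<beta> - \<alpha>) + K * (\<kappa> * (\<beta> - \<alpha>))"
    using ab(4) K by (intro add_left_mono mult_left_mono) auto
  finally have "(\<beta> - \<alpha>) * (1 / \<beta>) \<le> (\<beta> - \<alpha>) * ((1 - \<delta>) / \<alpha> + K * \<kappa>)" by (simp add: algebra_simps)
  then have "1 / \<beta> \<le> (1 - \<delta>) / \<alpha> + K * \<kappa>" using ab(1) by (simp only: mult_le_cancel_left_pos diff_gt_0_iff_gt)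
  then have "\<alpha> * (1 / \<beta>) \<le> \<alpha> * ((1 - \<delta>) / \<alpha> + K * \<kappa>)" using al by (intro mult_left_mono) auto
  then have 1: "\<alpha> / \<beta> \<le> 1 - \<delta> + \<alpha> * K * \<kappa>" using al by (simp add: distrib_left)
  have "\<alpha> * K * \<kappa> \<le> U * K * (\<delta> / (4 * K * U))"
    using \<kappa> K al LU ab(1) U by (intro mult_mono) auto
  then have 2: "\<alpha> * K * \<kappa> \<le> \<delta> / 4" using K U by simp
  have "\<delta> * L / 4 \<le> \<delta> / 4 * \<beta>" using LU ab(1) \<delta> by simp
  then have "\<alpha> \<ge> (1 - \<delta> / 4) * \<beta>" using ab(2) by (simp add: algebra_simps)
  then have 3: "\<alpha> / \<beta> \<ge> 1 - \<delta> / 4" using al by (simp add: le_divide_eq)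
  from 1 2 3 \<delta> show False by linarith
qed

lemma prime_shift_count_eq_card_hits:
  "prime_shift_count c a (real n) = card {p \<in> primes_le n. c \<in> hits a p}"
  unfolding prime_shift_count_def primes_le_def hits_def by (intro arg_cong[of _ _ card]) auto

text \<open>A real \<open>z\<close> strictly between the limsup and \<open>1\<close> leaves room for
  a deficit \<open>1 / (j + 2)\<close>; the offset \<open>2\<close> keeps this deficit below
  \<open>1\<close>.\<close>

lemma Limsup_less_1_imp_exceptional:
  assumes c: "c > 0"
    and less: "Limsup at_top (\<lambda>x::real. ereal (c * real (prime_shift_count c a x) / (x / (ln x)\<^sup>2))) < 1"
  shows "\<exists>j k N. c \<in> exceptional_set a (1 / (real j + 2)) N (1 / (real k + 1)) (real k + 1)"
proof -
  obtain z :: real where z: "Limsup at_top (\<lambda>x::real. ereal (c * real (prime_shift_count c a x) / (x / (ln x)\<^sup>2))) < ereal z"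
      "ereal z < 1"
    using ereal_dense2[OF less] by blast
  have "eventually (\<lambda>x::real. ereal (c * real (prime_shift_count c a x) / (x / (ln x)\<^sup>2)) < ereal z) at_top"
    by (rule Limsup_lessD[OF z(1)])
  then obtain x0 where x0: "\<And>x. x \<ge> x0 \<Longrightarrow> c * real (prime_shift_count c a x) / (x / (ln x)\<^sup>2) < z"
    by (auto simp: eventually_at_top_linorder)
  have z1: "z < 1" using z(2) by (simp add: one_ereal_def)
  obtain j where "inverse (real (Suc j)) < 1 - z" using reals_Archimedean[of "1 - z"] z1 by auto
  moreover have "1 / (real j + 2) \<le> inverse (real (Suc j))" by (simp add: field_simps)
  ultimately have j: "z \<le> 1 - 1 / (real j + 2)" by linarith
  obtain k where k: "real k \<ge> max c (1 / c)" using real_arch_simple by blast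
  have ck: "1 / (real k + 1) \<le> c" "c \<le> real k + 1" using k c by (auto simp: field_simps)
  \<comment> \<open>From \<open>2\<close> on, \<open>ln n\<close> is positive and the normalizing
    quotient can be multiplied out.\<close>
  define N where "N = max 2 (nat \<lceil>x0\<rceil>)"
  have "c * real (card {p \<in> primes_le n. c \<in> hits a p}) \<le> (1 - 1 / (real j + 2)) * (n / (ln n)\<^sup>2)" if "n \<ge> N" for n
  proof -
    have n: "n \<ge> 2" "real n \<ge> x0" using that by (auto simp: N_def)
    then have y: "n / (ln n)\<^sup>2 > 0" by simp
    have "c * real (card {p \<in> primes_le n. c \<in> hits a p}) / (n / (ln n)\<^sup>2) \<le> 1 - 1 / (real j + 2)"
      using x0[OF n(2)] j by (simp add: prime_shift_count_eq_card_hits)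
    then show ?thesis using y by (simp only: pos_divide_le_eq)
  qed
  then have "c \<in> exceptional_set a (1 / (real j + 2)) N (1 / (real k + 1)) (real k + 1)"
    using ck unfolding exceptional_set_def by simp
  then show ?thesis by blast
qed

lemma null_Union_exceptional_sets:
  "(\<Union>a\<in>{1..}. \<Union>j k N. exceptional_set a (1 / (real j + 2)) N (1 / (real k + 1)) (real k + 1))
     \<in> null_sets lebesgue"
proof (intro null_sets_UN')
  fix a :: int and j k N :: nat
  assume "a \<in> {1..}"
  then have "a \<ge> 1" by simp
  moreover have "1 / (real k + 1) \<le> 1" by simp
  then have "1 / (real k + 1) \<le> real k + 1" by linarith
  ultimately show "exceptional_set a (1 / (real j + 2)) N (1 / (real k + 1)) (real k + 1) \<in> null_sets lebesgue"
    by (intro null_exceptional_set) simp_all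
qed simp_all

theorem theorem3:
  shows "AE c in (lebesgue :: real measure). c > 0 \<and> c \<notin> \<int> \<longrightarrow>
           (\<forall>a::int. a \<ge> 1 \<longrightarrow>
             Limsup at_top (\<lambda>x::real.
               ereal (c * real (prime_shift_count c a x) / (x / (ln x)\<^sup>2))) \<ge> 1)"
proof (rule AE_I'[OF null_Union_exceptional_sets], rule subsetI, rule ccontr)
  fix c assume c: "c \<in> {c \<in> space lebesgue. \<not> (c > 0 \<and> c \<notin> \<int> \<longrightarrow> (\<forall>a::int. a \<ge> 1 \<longrightarrow>
      Limsup at_top (\<lambda>x::real. ereal (c * real (prime_shift_count c a x) / (x / (ln x)\<^sup>2))) \<ge> 1))}"
    and not_exc: "c \<notin> (\<Union>a\<in>{1..}. \<Union>j k N. exceptional_set a (1 / (real j + 2)) N (1 / (real k + 1)) (real k + 1))"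
  from c obtain a :: int where "c > 0" and a: "a \<ge> 1"
    and "\<not> Limsup at_top (\<lambda>x::real. ereal (c * real (prime_shift_count c a x) / (x / (ln x)\<^sup>2))) \<ge> 1"
    by blast
  then obtain j k N where "c \<in> exceptional_set a (1 / (real j + 2)) N (1 / (real k + 1)) (real k + 1)"
    using Limsup_less_1_imp_exceptional[of c a] unfolding not_le by blast
  with a not_exc show False by blast
qed

end
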